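(* Let $G$ be a finite simple graph that is $(P_2\cup P_4,\ \mathrm{HVN})$-free. Then \[ \chi(G)\le\begin{cases}4 & \text{if } \omega(G)=2,\\ 10 & \text{if } \omega(G)=3,\\ \left\lceil \tfrac{4}{3}\omega(G)\right\rceil & \text{if } \omega(G)\ge 4.\end{cases} \] Moreover, these bounds are tight for every value of $\omega(G)\neq 3$: there exists a $(P_2\cup P_4,\ \mathrm{HVN})$-free graph with clique number $2$ and chromatic number $4$, and for every integer $\omega\ge 4$ there exists a $(P_2\cup P_4,\ \mathrm{HVN})$-free graph with clique number $\omega$ and chromatic number $\lceil \frac{4}{3}\omega\rceil$.
   Context: All graphs are finite and simple. $P_n$ denotes the path on $n$ vertices and $K_n$ the complete graph on $n$ vertices. $P_2\cup P_4$ is the disjoint union of $P_2$ and $P_4$. The HVN is the graph obtained from $K_5$ by deleting two edges incident to the same vertex. A graph $G$ is $H$-free if no induced subgraph of $G$ is isomorphic to $H$, and $(H_1,H_2)$-free if it is both $H_1$-free and $H_2$-free. $\chi(G)$ is the chromatic number and $\omega(G)$ the clique number of $G$. *)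

theory Defs
  imports Complex_Main "HOL-Library.Ramsey"
begin

type_synonym 'a sgraph = "'a set \<times> 'a set set"

abbreviation verts :: "'a sgraph \<Rightarrow> 'a set" where
  "verts \<equiv> fst"

abbreviation edges :: "'a sgraph \<Rightarrow> 'a set set" where
  "edges \<equiv> snd"

definition fin_sgraph :: "'a sgraph \<Rightarrow> bool" where
  "fin_sgraph G \<longleftrightarrow> finite (verts G) \<and> (\<forall>e \<in> edges G. e \<subseteq> verts G \<and> card e = 2)"

definition induced :: "'a sgraph \<Rightarrow> 'a set \<Rightarrow> 'a sgraph" where
  "induced G S = (S, {e \<in> edges G. e \<subseteq> S})"

text \<open>Edges are two-element sets, so the case \<open>u = v\<close> below is harmless: \<open>{u, u}\<close> is never an edge of a
  simple graph.\<close>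

definition graph_iso :: "'a sgraph \<Rightarrow> 'b sgraph \<Rightarrow> bool" where
  "graph_iso G H \<longleftrightarrow>
     (\<exists>f. bij_betw f (verts G) (verts H) \<and>
          (\<forall>u \<in> verts G. \<forall>v \<in> verts G. {u, v} \<in> edges G \<longleftrightarrow> {f u, f v} \<in> edges H))"

definition free_of :: "'b sgraph \<Rightarrow> 'a sgraph \<Rightarrow> bool" where
  "free_of H G \<longleftrightarrow> \<not> (\<exists>S \<subseteq> verts G. graph_iso (induced G S) H)"

definition path_graph :: "nat \<Rightarrow> nat sgraph" where
  "path_graph n = ({..<n}, {{i, Suc i} | i. Suc i < n})"

definition complete_graph :: "nat \<Rightarrow> nat sgraph" where
  "complete_graph n = ({..<n}, {{i, j} | i j. i < n \<and> j < n \<and> i \<noteq> j})"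

definition disjoint_union :: "'a sgraph \<Rightarrow> 'b sgraph \<Rightarrow> ('a + 'b) sgraph" where
  "disjoint_union G H =
     (verts G <+> verts H, (\<lambda>e. Inl ` e) ` edges G \<union> (\<lambda>e. Inr ` e) ` edges H)"

definition P2_P4 :: "(nat + nat) sgraph" where
  "P2_P4 = disjoint_union (path_graph 2) (path_graph 4)"

definition HVN :: "nat sgraph" where
  "HVN = (verts (complete_graph 5), edges (complete_graph 5) - {{0, 1}, {0, 2}})"

definition proper_coloring :: "'a sgraph \<Rightarrow> nat \<Rightarrow> ('a \<Rightarrow> nat) \<Rightarrow> bool" where
  "proper_coloring G k c \<longleftrightarrow>
     (\<forall>v \<in> verts G. c v < k) \<and>
     (\<forall>u \<in> verts G. \<forall>v \<in> verts G. {u, v} \<in> edges G \<longrightarrow> c u \<noteq> c v)"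

text \<open>The two parameters below are meant for finite graphs only; \<open>LEAST\<close> and \<open>Max\<close> are unspecified
  where no finite colouring or no largest clique exists.\<close>

definition chromatic_number :: "'a sgraph \<Rightarrow> nat" where
  "chromatic_number G = (LEAST k. \<exists>c. proper_coloring G k c)"

definition clique_number :: "'a sgraph \<Rightarrow> nat" where
  "clique_number G = Max {card K | K. K \<subseteq> verts G \<and> clique K (edges G)}"

end

theory Submission
  imports Defs "HOL-Library.Countable"
begin

text \<open>The vertices adjacent to neither end of an edge induce a \<open>P\<^sub>4\<close>-free graph, which a greedy colouring
  colours with as many colours as its clique number; for clique numbers 2 and 3 this gives the bounds
  at once.

  Let \<open>w \<ge> 4\<close> be the clique number. By HVN-freeness a maximum clique extends to a complete
  multipartite graph \<open>M\<close> with \<open>w\<close> parts such that every other vertex sees at most one part of \<open>M\<close>, and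
  then the vertices outside \<open>M\<close> that see neither of two given parts induce a \<open>P\<^sub>4\<close>-free graph. If
  \<open>V - M\<close> has no \<open>K\<^sub>4\<close>, then \<open>w + 2\<close> colours suffice: the vertices seeing parts \<open>i\<close> or \<open>j\<close> and the
  other ones are coloured separately, and each of the two classes can reuse the colours of the parts
  that it does not see. Otherwise a maximum clique of \<open>V - M\<close> gives a second complete multipartite
  graph \<open>M'\<close>, and \<open>R = V - M - M'\<close> remains. If \<open>R\<close> is independent, then \<open>M\<close> and \<open>M'\<close> are coloured with
  \<open>\<lceil>4w/3\<rceil>\<close> colours, at most two for each part, and \<open>R\<close> is coloured greedily. An edge of \<open>R\<close> forbids most
  edges between \<open>M\<close> and \<open>M'\<close>, and \<open>w + 2\<close> colours suffice again. Two complete multipartite graphs joined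
  by a perfect matching that connects any two parts of different sides show that \<open>\<lceil>4w/3\<rceil>\<close> is attained.\<close>

text \<open>The obstacle is the case of exactly four parts. An edge of \<open>R\<close> together
  with one further vertex excludes at most three part indices. Two free indices always lead to a
  contradiction: either they give an edge that misses some \<open>P4\<close>, or some vertex sees
  two parts although it may see only one. So an edge of \<open>R\<close> whose ends see
  \<open>M\<close> and \<open>M'\<close> in essentially different ways survives only if both
  multipartite graphs have four parts, and then the views of its ends are rigid enough for a direct
  colouring. The value 4/3 comes from a count. If \<open>w - e\<close> parts on each side are
  monochromatic, these need up to \<open>2 * (w - e)\<close> different colours, while
  \<open>e\<close> parts with two colours cost \<open>w + e\<close> colours on one side. The two
  numbers balance at \<open>w = 3 * e\<close>. The other cases get by with \<open>w + 2\<close>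
  colours, which is at most \<lceil>4w/3\<rceil> exactly because \<open>w\<close> is at least 4; for
  \<open>w\<close> equal to 4, 5 or 6 the two numbers coincide and there is no slack.\<close>

lemma obtain_avoiding:
  fixes t :: nat
  assumes "finite A" "card A < t" obtains i where "i < t" "i \<notin> A"
proof -
  have "\<not> {..<t} \<subseteq> A" using card_mono[OF assms(1), of "{..<t}"] assms(2) by auto
  then show ?thesis using that by blast
qed

text \<open>The typical use of having four parts: the views of both ends of an edge and one
  distinguished part still leave a part to choose from.\<close>

lemma obtain_less_avoiding3:
  fixes t :: nat
  assumes "3 < t" obtains i where "i < t" "i \<noteq> a" "i \<noteq> b" "i \<noteq> c"
  by (rule obtain_avoiding[of "{a, b, c}" t]) (use assms in \<open>auto simp: card_insert_if\<close>)

text \<open>The counting behind every exceptional configuration: if two free indices are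
  contradictory, the excluded indices must be three different parts out of exactly four.\<close>

lemma three_distinct_if_at_most_one_avoids:
  fixes t :: nat
  assumes t: "4 \<le> t"
    and one: "\<And>i j. \<lbrakk>i < t; j < t; i \<notin> {a, b, c}; j \<notin> {a, b, c}\<rbrakk> \<Longrightarrow> i = j"
  shows "t = 4 \<and> a < t \<and> b < t \<and> c < t \<and> a \<noteq> b \<and> a \<noteq> c \<and> b \<noteq> c"
proof -
  let ?A = "{..<t} - {a, b, c}" and ?B = "{..<t} \<inter> {a, b, c}"
  have A: "card ?A \<le> Suc 0" by (subst card_le_Suc0_iff_eq) (use one in auto)
  have B: "card ?B \<le> card {a, b, c}" by (intro card_mono) auto
  have C: "card {a, b, c} \<le> 3" by (simp add: card_insert_if)
  have "card {..<t} = card ?B + card ?A" by (rule card_Int_Diff) simp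
  then have eq: "t = 4" "card {a, b, c} = 3" "card ?B = card {a, b, c}"
    using A B C t by simp_all
  have "?B = {a, b, c}" by (rule card_subset_eq) (use eq in auto)
  then show ?thesis using eq by (auto simp: card_insert_if split: if_splits)
qed

section \<open>Colourings of \<open>P\<^sub>4\<close>-free graphs\<close>

locale graph =
  fixes V :: "'a set" and E :: "'a \<Rightarrow> 'a \<Rightarrow> bool"
  assumes finite_V: "finite V"
    and E_in_V: "E x y \<Longrightarrow> x \<in> V"
    and sym: "E x y \<Longrightarrow> E y x"
    and irrefl: "\<not> E x x"
begin

lemma E_commute: "E x y \<longleftrightarrow> E y x"
  using sym by blast

definition colorable :: "'a set \<Rightarrow> nat \<Rightarrow> bool" where
  "colorable S k \<longleftrightarrow> (\<exists>c. (\<forall>v\<in>S. c v < k) \<and> (\<forall>u\<in>S. \<forall>v\<in>S. E u v \<longrightarrow> c u \<noteq> c v))"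

definition is_clique :: "'a set \<Rightarrow> bool" where
  "is_clique Q \<longleftrightarrow> (\<forall>u\<in>Q. \<forall>v\<in>Q. u \<noteq> v \<longrightarrow> E u v)"

text \<open>The four vertices are automatically distinct: equating two of them turns a required edge
  into a forbidden one.\<close>

definition is_P4 :: "'a \<Rightarrow> 'a \<Rightarrow> 'a \<Rightarrow> 'a \<Rightarrow> bool" where
  "is_P4 a b c d \<longleftrightarrow> E a b \<and> E b c \<and> E c d \<and> \<not> E a c \<and> \<not> E a d \<and> \<not> E b d"

lemma colorable_mono: "colorable S k \<Longrightarrow> k \<le> l \<Longrightarrow> colorable S l"
  unfolding colorable_def by (meson less_le_trans)

lemma colorable_subset: "colorable S k \<Longrightarrow> T \<subseteq> S \<Longrightarrow> colorable T k"
  unfolding colorable_def by (meson subsetD)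

lemma colorable_independent:
  assumes "\<And>u v. u \<in> S \<Longrightarrow> v \<in> S \<Longrightarrow> \<not> E u v" shows "colorable S 1"
  unfolding colorable_def using assms by (intro exI[of _ "\<lambda>_. 0"]) auto

lemma colorable_union:
  assumes "colorable S k" "colorable T l" shows "colorable (S \<union> T) (k + l)"
proof -
  obtain c where c: "\<forall>v\<in>S. c v < k" "\<forall>u\<in>S. \<forall>v\<in>S. E u v \<longrightarrow> c u \<noteq> c v"
    using assms(1) unfolding colorable_def by auto
  obtain d where d: "\<forall>v\<in>T. d v < l" "\<forall>u\<in>T. \<forall>v\<in>T. E u v \<longrightarrow> d u \<noteq> d v"
    using assms(2) unfolding colorable_def by auto
  show ?thesis unfolding colorable_def
    by (rule exI[of _ "\<lambda>v. if v \<in> S then c v else k + d v"])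
      (use c d in \<open>auto simp: trans_less_add1; fastforce\<close>)
qed

lemma is_cliqueD: "is_clique Q \<Longrightarrow> u \<in> Q \<Longrightarrow> v \<in> Q \<Longrightarrow> u \<noteq> v \<Longrightarrow> E u v"
  unfolding is_clique_def by blast

lemma is_clique_subset: "is_clique Q \<Longrightarrow> R \<subseteq> Q \<Longrightarrow> is_clique R"
  unfolding is_clique_def by blast

lemma is_clique_insert: "is_clique Q \<Longrightarrow> (\<And>q. q \<in> Q \<Longrightarrow> E v q) \<Longrightarrow> is_clique (insert v Q)"
  unfolding is_clique_def using sym by blast

lemma max_clique:
  assumes "finite U"
  obtains Q where "Q \<subseteq> U" "is_clique Q" "\<And>R. R \<subseteq> U \<Longrightarrow> is_clique R \<Longrightarrow> card R \<le> card Q"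
proof -
  let ?P = "\<lambda>Q. Q \<subseteq> U \<and> is_clique Q"
  have "?P {}" by (simp add: is_clique_def)
  moreover have "\<forall>Q. ?P Q \<longrightarrow> card Q < Suc (card U)"
    using assms by (simp add: card_mono le_imp_less_Suc)
  ultimately obtain Q where "?P Q" "\<forall>R. ?P R \<longrightarrow> card R \<le> card Q"
    using ex_has_greatest_nat[of ?P "{}" card "Suc (card U)"] by fastforce
  then show ?thesis using that by blast
qed

text \<open>A proper colouring minimising the sum of all colours is greedy: each vertex has neighbours in
  all smaller colours. A vertex of colour \<open>n\<close> then starts a clique that is extended downwards
  through all colours \<open>i \<le> n\<close>: if no vertex of colour \<open>i\<close> sees the whole clique, two of them
  span a \<open>P\<^sub>4\<close> with two clique vertices.\<close>

lemma P4_free_colorable: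
  assumes fin: "finite S"
    and P4: "\<And>a b c d. \<lbrakk>a \<in> S; b \<in> S; c \<in> S; d \<in> S; is_P4 a b c d\<rbrakk> \<Longrightarrow> False"
    and cl: "\<And>Q. \<lbrakk>Q \<subseteq> S; is_clique Q\<rbrakk> \<Longrightarrow> card Q \<le> k"
  shows "colorable S k"
proof -
  let ?P = "\<lambda>c::'a \<Rightarrow> nat. \<forall>u\<in>S. \<forall>v\<in>S. E u v \<longrightarrow> c u \<noteq> c v"
  obtain c0 :: "'a \<Rightarrow> nat" where "inj_on c0 S"
    using finite_imp_inj_to_nat_seg[OF fin] by auto
  then have "?P c0" using irrefl by (metis inj_onD)
  then obtain c where c: "?P c" and cmin: "\<And>d. ?P d \<Longrightarrow> sum c S \<le> sum d S"
    using ex_has_least_nat[of ?P c0 "\<lambda>c. sum c S"] by blast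
  have greedy: "\<exists>u\<in>S. E u v \<and> c u = i" if v: "v \<in> S" and i: "i < c v" for v i
  proof (rule ccontr)
    assume no: "\<not> ?thesis"
    have "?P (c(v := i))" using c no irrefl sym by (auto simp: E_commute)
    then have "sum c S \<le> sum (c(v := i)) S" by (rule cmin)
    moreover have "sum (c(v := i)) S < sum c S"
      using fin v i by (intro sum_strict_mono_ex1) auto
    ultimately show False by simp
  qed
  have "c v < k" if v: "v \<in> S" for v
  proof -
    let ?C = "\<lambda>i. \<exists>Q\<subseteq>S. is_clique Q \<and> inj_on c Q \<and> c ` Q = {i..c v}"
    have step: "?C i" if iv: "i < c v" and CS: "?C (Suc i)" for i
    proof -
      obtain Q where Q: "Q \<subseteq> S" "is_clique Q" "inj_on c Q" "c ` Q = {Suc i..c v}"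
        using CS by blast
      have finQ: "finite Q" using Q(1) fin finite_subset by blast
      let ?I = "{x\<in>S. c x = i}"
      obtain v' where v': "v' \<in> ?I" using greedy[OF v iv] by blast
      \<comment> \<open>\<open>x\<close> has the most neighbours in \<open>Q\<close> within its
        colour class. If it misses \<open>q\<close>, then some \<open>y\<close> of colour
        \<open>i\<close> sees \<open>q\<close>, and by maximality \<open>y\<close> misses a
        neighbour \<open>q'\<close> of \<open>x\<close>; this gives the path
        \<open>x q' q y\<close>.\<close>
      obtain x where x: "x \<in> ?I"
        and xmax: "\<And>y. y \<in> ?I \<Longrightarrow> card {q\<in>Q. E y q} \<le> card {q\<in>Q. E x q}"
      proof -
        have "\<forall>y. y \<in> ?I \<longrightarrow> card {q\<in>Q. E y q} < Suc (card Q)"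
          using card_mono[OF finQ] by (simp add: le_imp_less_Suc)
        then have "\<exists>x. x \<in> ?I \<and> (\<forall>y. y \<in> ?I \<longrightarrow> card {q\<in>Q. E y q} \<le> card {q\<in>Q. E x q})"
          by (rule ex_has_greatest_nat[rotated]) (rule v')
        then show ?thesis using that by blast
      qed
      have all: "E x q" if q: "q \<in> Q" for q
      proof (rule ccontr)
        assume xq: "\<not> E x q"
        have "c q \<in> {Suc i..c v}" using Q(4) q by blast
        then obtain y where y: "y \<in> S" "E y q" "c y = i" using greedy[of q i] q Q(1) by auto
        have "\<exists>q'\<in>Q. E x q' \<and> \<not> E y q'"
        proof (rule ccontr)
          assume "\<not> ?thesis"
          then have "{q\<in>Q. E x q} \<subset> {q\<in>Q. E y q}" using xq q sym[OF y(2)] y(2) by blast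
          then have "card {q\<in>Q. E x q} < card {q\<in>Q. E y q}"
            using finQ by (intro psubset_card_mono) auto
          with xmax[of y] y show False by simp
        qed
        then obtain q' where q': "q' \<in> Q" "E x q'" "\<not> E y q'" by blast
        have "E q' q" using q' q xq Q(2) unfolding is_clique_def by metis
        moreover have "\<not> E x y" using c x y by auto
        ultimately have "is_P4 x q' q y"
          unfolding is_P4_def using q' xq y sym by blast
        then show False using P4 x q' q y Q(1) by blast
      qed
      have "is_clique (insert x Q)" using is_clique_insert[OF Q(2) all] .
      moreover have "c x \<notin> c ` Q" using Q(4) x by auto
      then have "inj_on c (insert x Q)" using Q(3) by auto
      moreover have "c ` insert x Q = {i..c v}" using Q(4) x iv by auto
      ultimately show ?thesis using Q(1) x by (intro exI[of _ "insert x Q"]) simp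
    qed
    have "?C (c v)"
      by (rule exI[of _ "{v}"]) (use v in \<open>auto simp: is_clique_def\<close>)
    then have "?C 0" using step by (rule_tac inc_induct[of 0 "c v"]) auto
    then obtain Q where Q: "Q \<subseteq> S" "is_clique Q" "inj_on c Q" "c ` Q = {0..c v}" by blast
    then have "card Q = Suc (c v)" using card_image[OF Q(3)] by simp
    then show ?thesis using cl[OF Q(1,2)] by simp
  qed
  then show ?thesis using c unfolding colorable_def by blast
qed

section \<open>Complete multipartite subgraphs and the part that a vertex sees\<close>

definition multipartite :: "nat \<Rightarrow> 'a set \<Rightarrow> ('a \<Rightarrow> nat) \<Rightarrow> bool" where
  "multipartite t M p \<longleftrightarrow> p ` M = {..<t} \<and> (\<forall>m\<in>M. \<forall>n\<in>M. E m n \<longleftrightarrow> p m \<noteq> p n)"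

definition sees_one_part :: "'a set \<Rightarrow> ('a \<Rightarrow> nat) \<Rightarrow> 'a \<Rightarrow> bool" where
  "sees_one_part M p b \<longleftrightarrow> (\<forall>m\<in>M. \<forall>n\<in>M. E b m \<longrightarrow> E b n \<longrightarrow> p m = p n)"

text \<open>The value \<open>t\<close> means that no part is seen.\<close>

definition view :: "nat \<Rightarrow> 'a set \<Rightarrow> ('a \<Rightarrow> nat) \<Rightarrow> 'a \<Rightarrow> nat" where
  "view t M p b = (if \<exists>m\<in>M. E b m then p (SOME m. m \<in> M \<and> E b m) else t)"

lemma view_eq:
  assumes "sees_one_part M p b" "m \<in> M" "E b m" shows "view t M p b = p m"
proof -
  have "(SOME m. m \<in> M \<and> E b m) \<in> M \<and> E b (SOME m. m \<in> M \<and> E b m)"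
    by (rule someI[of _ m]) (use assms in auto)
  with assms have "p (SOME m. m \<in> M \<and> E b m) = p m" unfolding sees_one_part_def by blast
  moreover have "\<exists>m\<in>M. E b m" using assms by blast
  ultimately show ?thesis unfolding view_def by simp
qed

lemma view_less:
  assumes "view t M p b < t" obtains m where "m \<in> M" "E b m"
  using assms unfolding view_def by (auto split: if_splits)

lemma view_le:
  assumes "multipartite t M p" shows "view t M p b \<le> t"
proof (cases "\<exists>m\<in>M. E b m")
  case True
  then have "\<exists>m. m \<in> M \<and> E b m" by blast
  from someI_ex[OF this] have "(SOME m. m \<in> M \<and> E b m) \<in> M" ..
  then have "p (SOME m. m \<in> M \<and> E b m) < t" using assms unfolding multipartite_def by blast
  then show ?thesis using True unfolding view_def by simp
qed (auto simp: view_def)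

lemma multipartite_rep:
  assumes "multipartite t M p" "i < t" obtains m where "m \<in> M" "p m = i"
  using assms unfolding multipartite_def by (metis imageE lessThan_iff)

lemma multipartite_part: "multipartite t M p \<Longrightarrow> m \<in> M \<Longrightarrow> p m < t"
  unfolding multipartite_def by blast

lemma multipartite_E: "multipartite t M p \<Longrightarrow> m \<in> M \<Longrightarrow> n \<in> M \<Longrightarrow> E m n \<longleftrightarrow> p m \<noteq> p n"
  unfolding multipartite_def by blast

lemma finite_subset_V: "S \<subseteq> V \<Longrightarrow> finite S"
  using finite_V finite_subset by blast

lemma colorable_palette:
  assumes "colorable S k" "finite L" "k \<le> card L"
  obtains c where "\<And>v. v \<in> S \<Longrightarrow> c v \<in> L" "\<And>u v. u \<in> S \<Longrightarrow> v \<in> S \<Longrightarrow> E u v \<Longrightarrow> c u \<noteq> (c v :: nat)"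
proof -
  obtain c where c: "\<forall>v\<in>S. c v < k" "\<forall>u\<in>S. \<forall>v\<in>S. E u v \<longrightarrow> c u \<noteq> c v"
    using assms(1) unfolding colorable_def by auto
  obtain f where f: "f ` {..<k} \<subseteq> L" "inj_on f {..<k}"
    using card_le_inj[of "{..<k}" L] assms(2,3) by auto
  show ?thesis
  proof (rule that)
    show "(f \<circ> c) v \<in> L" if "v \<in> S" for v using c(1) f(1) that by auto
    show "(f \<circ> c) u \<noteq> (f \<circ> c) v" if "u \<in> S" "v \<in> S" "E u v" for u v
      using c that inj_onD[OF f(2), of "c u" "c v"] by auto
  qed
qed

text \<open>Vertices of an independent set do not constrain each other, so each of them only needs a
  colour outside its own forbidden set.\<close>

lemma colorable_extend_independent:
  assumes c: "\<And>v. v \<in> S \<Longrightarrow> c v < k" "\<And>u v. u \<in> S \<Longrightarrow> v \<in> S \<Longrightarrow> E u v \<Longrightarrow> c u \<noteq> (c v :: nat)"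
    and ind: "\<And>u v. u \<in> T \<Longrightarrow> v \<in> T \<Longrightarrow> \<not> E u v"
    and few: "\<And>v. v \<in> T \<Longrightarrow> finite (A v) \<and> card (A v) < k \<and> (\<forall>u\<in>S. E u v \<longrightarrow> c u \<in> A v)"
  shows "colorable (S \<union> T) k"
proof -
  have "\<exists>i. v \<in> T \<longrightarrow> i < k \<and> i \<notin> A v" for v
    using obtain_avoiding[of "A v" k] few[of v] by metis
  then obtain g where g: "\<And>v. v \<in> T \<Longrightarrow> g v < k \<and> g v \<notin> A v" by metis
  let ?c = "\<lambda>v. if v \<in> S then c v else g v"
  have "?c u \<noteq> ?c v" if uv: "u \<in> S \<union> T" "v \<in> S \<union> T" "E u v" for u v
  proof (cases "u \<in> S"; cases "v \<in> S")
    assume "u \<in> S" "v \<notin> S"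
    then show ?thesis using few[of v] g[of v] uv by auto
  next
    assume "u \<notin> S" "v \<in> S"
    then show ?thesis using few[of u] g[of u] uv sym[OF uv(3)] by auto
  qed (use uv c(2) ind in auto)
  then show ?thesis
    unfolding colorable_def using c(1) g by (intro exI[of _ ?c]) auto
qed

lemma transversal_clique:
  assumes "multipartite t M p" "x \<in> M"
  obtains Q where "Q \<subseteq> M" "is_clique Q" "card Q = t" "x \<in> Q"
proof -
  have "\<exists>m. i < t \<longrightarrow> m \<in> M \<and> p m = i" for i
    by (metis multipartite_rep[OF assms(1)])
  then obtain f where f: "\<And>i. i < t \<Longrightarrow> f i \<in> M \<and> p (f i) = i" by metis
  define g where "g = f(p x := x)"
  have g: "g i \<in> M \<and> p (g i) = i" if "i < t" for i
    using f[OF that] assms(2) unfolding g_def by auto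
  show ?thesis
  proof (rule that[of "g ` {..<t}"])
    show "is_clique (g ` {..<t})"
      unfolding is_clique_def using g multipartite_E[OF assms(1)] by auto
    have "inj_on g {..<t}" by (rule inj_on_inverseI[of _ p]) (use g in auto)
    then show "card (g ` {..<t}) = t" by (simp add: card_image)
    show "x \<in> g ` {..<t}"
      using multipartite_part[OF assms] by (intro image_eqI[of _ _ "p x"]) (auto simp: g_def)
  qed (use g in auto)
qed

end

section \<open>Clique numbers two and three\<close>

text \<open>An end of the edge that lies on the path has a neighbour on it, so the axiom is true of
  overlapping edges and amounts to the absence of an induced P2 + P4.\<close>

locale P2_P4_free_graph = graph +
  assumes P2_P4: "is_P4 a b c d \<Longrightarrow> E x y \<Longrightarrow>
    E x a \<or> E x b \<or> E x c \<or> E x d \<or> E y a \<or> E y b \<or> E y c \<or> E y d"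
begin

lemma colorable_nonneighbours:
  assumes "E x y" "S \<subseteq> V" "\<And>v. v \<in> S \<Longrightarrow> \<not> E x v \<and> \<not> E y v"
    and "\<And>Q. Q \<subseteq> S \<Longrightarrow> is_clique Q \<Longrightarrow> card Q \<le> k"
  shows "colorable S k"
proof (rule P4_free_colorable)
  show False if "a \<in> S" "b \<in> S" "c \<in> S" "d \<in> S" "is_P4 a b c d" for a b c d
    using P2_P4[OF that(5) assms(1)] assms(3) that by blast
qed (use assms finite_subset_V in auto)

text \<open>4 = 1 + 1 + 2: the neighbourhoods of \<open>x\<close> and \<open>y\<close> are
  independent, and the common non-neighbours of the edge need two colours.\<close>

lemma colorable_if_triangle_free:
  assumes cl: "\<And>Q. Q \<subseteq> V \<Longrightarrow> is_clique Q \<Longrightarrow> card Q \<le> 2"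
  shows "colorable V 4"
proof (cases "\<exists>x y. E x y")
  case False
  then have "colorable V 1" by (intro colorable_independent) auto
  then show ?thesis by (rule colorable_mono) simp
next
  case True
  then obtain x y where xy: "E x y" by blast
  have nbr: "colorable {v. E x v} 1" for x
  proof (rule colorable_independent, clarify)
    fix u v assume uv: "E x u" "E x v" "E u v"
    then have "card {x, u, v} = 3" using irrefl by (auto simp: card_insert_if)
    moreover have "is_clique {x, u, v}" using uv sym unfolding is_clique_def by blast
    moreover have "{x, u, v} \<subseteq> V" using uv E_in_V sym by blast
    ultimately show False using cl[of "{x, u, v}"] by simp
  qed
  let ?R = "{v \<in> V. \<not> E x v \<and> \<not> E y v}"
  have "colorable ?R 2"
    by (rule colorable_nonneighbours[OF xy]) (use cl in auto)
  from colorable_union[OF colorable_union[OF nbr[of x] nbr[of y]] this]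
  have "colorable ({v. E x v} \<union> {v. E y v} \<union> ?R) 4" by (simp add: eval_nat_numeral)
  then show ?thesis by (rule colorable_subset) blast
qed

text \<open>10 = 3 + (2 + 2) + (1 + 1 + 1): vertices missing \<open>a\<close> and \<open>b\<close>;
  those seeing only \<open>b\<close> or only \<open>a\<close> of the triangle, where that neighbour
  lowers the clique bound to 2; and those seeing exactly two corners, which are independent. No
  vertex sees all three.\<close>

lemma colorable_if_K4_free:
  assumes cl: "\<And>Q. Q \<subseteq> V \<Longrightarrow> is_clique Q \<Longrightarrow> card Q \<le> 3"
    and abc: "E a b" "E a c" "E b c"
  shows "colorable V 10"
proof -
  have inV: "a \<in> V" "b \<in> V" "c \<in> V" using abc E_in_V sym by blast+
  have no4: False if "E x y" "E x u" "E x v" "E y u" "E y v" "E u v" for x y u v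
  proof -
    have "card {x, y, u, v} = 4" using that irrefl by (auto simp: card_insert_if)
    moreover have "is_clique {x, y, u, v}" using that sym unfolding is_clique_def by blast
    moreover have "{x, y, u, v} \<subseteq> V" using that E_in_V sym by blast
    ultimately show False using cl[of "{x, y, u, v}"] by simp
  qed
  have two: "colorable {v \<in> V. \<not> E x v \<and> \<not> E y v \<and> E z v} 2" (is "colorable ?S 2")
    if "E x y" "z \<in> V" for x y z
  proof (rule colorable_nonneighbours[OF that(1)])
    fix Q assume Q: "Q \<subseteq> ?S" "is_clique Q"
    have "is_clique (insert z Q)" using Q by (intro is_clique_insert) auto
    moreover have "insert z Q \<subseteq> V" "z \<notin> Q" using Q that(2) irrefl by auto
    ultimately show "card Q \<le> 2" using cl[of "insert z Q"] finite_subset_V by fastforce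
  qed auto
  have one: "colorable {v \<in> V. \<not> E x v \<and> E y v \<and> E z v} 1" if "E y z" for x y z
    by (rule colorable_independent) (use that no4 sym in blast)
  have three: "colorable {v \<in> V. \<not> E a v \<and> \<not> E b v} 3"
    by (rule colorable_nonneighbours[OF abc(1)]) (use cl in auto)
  note u = colorable_union[OF colorable_union[OF three colorable_union[OF two[OF abc(2) inV(2)] two[OF abc(3) inV(1)]]]
    colorable_union[OF one[OF abc(3), of a] colorable_union[OF one[OF abc(2), of b] one[OF abc(1), of c]]]]
  have "colorable V (3 + (2 + 2) + (1 + (1 + 1)))"
    by (rule colorable_subset[OF u]) (use no4 abc sym in blast)
  then show ?thesis by simp
qed

end

section \<open>Structure forced by excluding the HVN\<close>

locale free_graph = P2_P4_free_graph +
  assumes HVN: "\<lbrakk>E a b; E a c; E a d; E b c; E b d; E c d; E v a; E v b; v \<noteq> c; v \<noteq> d\<rbrakk>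
    \<Longrightarrow> E v c \<or> E v d"
begin

text \<open>Neighbours of \<open>v\<close> in two parts and non-neighbours in two other parts would
  form an HVN. Since at least two parts contain neighbours, a count over four parts leaves at most
  one part with non-neighbours.\<close>

lemma sees_all_but_one_part:
  assumes M: "multipartite t M p" and t: "4 \<le> t" and v: "v \<notin> M"
    and mn: "m \<in> M" "n \<in> M" "p m \<noteq> p n" "E v m" "E v n"
  obtains a where "a < t" "\<And>x. x \<in> M \<Longrightarrow> p x \<noteq> a \<Longrightarrow> E v x"
proof -
  \<comment> \<open>\<open>S\<close> and \<open>U\<close> mark the parts with a neighbour and with a
    non-neighbour of \<open>v\<close>; a part may be marked by both.\<close>
  define S where "S = (\<lambda>i. \<exists>x\<in>M. p x = i \<and> E v x)"
  define U where "U = (\<lambda>i. \<exists>x\<in>M. p x = i \<and> \<not> E v x)"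
  have H4: False if "S i" "S j" "U k" "U l" "distinct [i, j, k, l]" for i j k l
  proof -
    obtain s s' u u' where "s \<in> M" "p s = i" "E v s" "s' \<in> M" "p s' = j" "E v s'"
      "u \<in> M" "p u = k" "\<not> E v u" "u' \<in> M" "p u' = l" "\<not> E v u'"
      using \<open>S i\<close> \<open>S j\<close> \<open>U k\<close> \<open>U l\<close> unfolding S_def U_def by blast
    then show False using HVN[of s s' u u' v] multipartite_E[OF M] that(5) v by fastforce
  qed
  have SU: "S i \<or> U i" if i: "i < t" for i
  proof -
    obtain x where "x \<in> M" "p x = i" using multipartite_rep[OF M i] .
    then show ?thesis unfolding S_def U_def by blast
  qed
  define i j where ij_def: "i = p m" "j = p n"
  have ij: "i \<noteq> j" "S i" "S j" using mn ij_def unfolding S_def by auto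
  have *: False if "U e" "U e'" "e \<noteq> e'" "e \<noteq> i" "e \<noteq> j" for e e'
  proof -
    obtain h where h: "h < t" "h \<noteq> i" "h \<noteq> j" "h \<noteq> e" using obtain_less_avoiding3[of t i j e] t by auto
    then have "\<not> U h" using H4[of i j e h] ij that by auto
    then have "S h" using SU h by blast
    show False
    proof (cases "e' = i \<or> e' = j")
      case True
      then show False using H4[OF _ \<open>S h\<close> that(1,2), of "if e' = i then j else i"] ij h that by auto
    next
      case False
      then show False using H4[OF ij(2,3) that(1,2)] ij(1) that by auto
    qed
  qed
  have uniq: "e = e'" if U: "U e" "U e'" for e e'
  proof (rule ccontr)
    assume ne: "e \<noteq> e'"
    then have ee: "e \<in> {i, j}" "e' \<in> {i, j}" using *[of e e'] *[of e' e] U by auto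
    obtain g where g: "g < t" "g \<noteq> i" "g \<noteq> j" using obtain_less_avoiding3[of t i j j] t by auto
    obtain h where h: "h < t" "h \<noteq> i" "h \<noteq> j" "h \<noteq> g" using obtain_less_avoiding3[of t i j g] t by auto
    have "S g" "S h" using *[of g e] *[of h e] U SU g h ee by blast+
    then show False using H4[of g h e e'] U ne ee g h by auto
  qed
  show ?thesis
  proof (cases "\<exists>e. U e")
    case True
    then obtain e where e: "U e" by blast
    then have "e < t" using multipartite_part[OF M] unfolding U_def by blast
    then show ?thesis using that[of e] uniq[OF e] unfolding U_def by blast
  next
    case False
    \<comment> \<open>Here \<open>v\<close> sees all of \<open>M\<close>, so any index serves as
      \<open>a\<close>.\<close>
    then show ?thesis using that[of 0] t unfolding U_def by fastforce
  qed
qed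

text \<open>\<open>M\<close> consists of the vertices of \<open>U\<close> that miss exactly one
  vertex of \<open>Q\<close>, and the missed vertex names the part. Equal names are non-adjacent by
  maximality. Vertices \<open>m\<close>, \<open>n\<close> with different names are adjacent:
  otherwise \<open>n\<close> together with the clique \<open>k, l, m, s n\<close> is an HVN, where
  \<open>|Q| \<ge> 4\<close> supplies \<open>k\<close> and \<open>l\<close>. An outside vertex
  seeing two parts would miss just one vertex of \<open>Q\<close> and so belong to \<open>M\<close>.
  The set \<open>U\<close> is later \<open>V\<close> and then \<open>V - M\<close>.\<close>

lemma maximum_clique_multipartite:
  assumes U: "U \<subseteq> V" and Q: "Q \<subseteq> U" "is_clique Q" "card Q = t" and t: "4 \<le> t"
    and max: "\<And>R. R \<subseteq> U \<Longrightarrow> is_clique R \<Longrightarrow> card R \<le> t"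
  obtains M p where "M \<subseteq> U" "multipartite t M p" "\<And>b. b \<in> U - M \<Longrightarrow> sees_one_part M p b"
proof -
  have finQ: "finite Q" using Q U finite_subset_V by blast
  have QE: "E k l \<longleftrightarrow> k \<noteq> l" if "k \<in> Q" "l \<in> Q" for k l
    using Q(2) that irrefl unfolding is_clique_def by metis
  \<comment> \<open>A vertex of \<open>Q\<close> misses only itself, hence \<open>Q\<close> lies in
    \<open>M\<close>.\<close>
  define M where "M = {v \<in> U. \<exists>!k. k \<in> Q \<and> \<not> E v k}"
  define s where "s = (\<lambda>v. THE k. k \<in> Q \<and> \<not> E v k)"
  have s: "s m \<in> Q" "\<not> E m (s m)" "\<And>k. k \<in> Q \<Longrightarrow> k \<noteq> s m \<Longrightarrow> E m k" if "m \<in> M" for m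
    using that theI'[of "\<lambda>k. k \<in> Q \<and> \<not> E m k"] unfolding M_def s_def by blast+
  have sQ: "k \<in> M" "s k = k" if "k \<in> Q" for k
  proof -
    show "k \<in> M" unfolding M_def using that Q(1) QE by auto
    show "s k = k" using s[OF \<open>k \<in> M\<close>] QE that by metis
  qed
  have swap: "is_clique (insert m (Q - {s m}))" "card (insert m (Q - {s m})) = t"
    "insert m (Q - {s m}) \<subseteq> U" if m: "m \<in> M" for m
  proof -
    show "is_clique (insert m (Q - {s m}))"
      by (rule is_clique_insert[OF is_clique_subset[OF Q(2)]]) (use s[OF m] in auto)
    have "m \<notin> Q - {s m}" using sQ(2)[of m] by auto
    then show "card (insert m (Q - {s m})) = t"
      using finQ s(1)[OF m] Q(3) t by (simp add: card_Diff_singleton)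
    show "insert m (Q - {s m}) \<subseteq> U" using Q(1) m unfolding M_def by auto
  qed
  have MU: "M \<subseteq> U" unfolding M_def by auto
  have same: "\<not> E m n" if mn: "m \<in> M" "n \<in> M" "s m = s n" for m n
  proof
    assume E: "E m n"
    let ?R = "insert n (insert m (Q - {s m}))"
    have "is_clique ?R"
      by (rule is_clique_insert[OF swap(1)[OF mn(1)]]) (use E s[OF mn(2)] mn(3) sym in auto)
    moreover have "n \<notin> insert m (Q - {s m})" using E irrefl sQ(2)[of n] mn(3) by auto
    moreover have "finite (insert m (Q - {s m}))" using finQ by simp
    ultimately have "card ?R = Suc t" using swap(2)[OF mn(1)] by (metis card_insert_disjoint)
    moreover have "?R \<subseteq> U" using swap(3)[OF mn(1)] MU mn(2) by auto
    ultimately show False using max[OF \<open>?R \<subseteq> U\<close> \<open>is_clique ?R\<close>] by simp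
  qed
  have diff: "E m n" if mn: "m \<in> M" "n \<in> M" "s m \<noteq> s n" for m n
  proof (rule ccontr)
    assume nE: "\<not> E m n"
    have nQ: "n \<notin> Q" "n \<noteq> m"
      using s(3)[OF mn(1), of n] sQ(2)[of n] nE mn(3) by auto
    have "card (Q - {s m, s n}) = t - 2"
      using finQ Q(3) s(1)[OF mn(1)] s(1)[OF mn(2)] mn(3) by (simp add: card_Diff_subset)
    then have "\<not> card (Q - {s m, s n}) \<le> Suc 0" using t by simp
    then obtain k l where kl: "k \<in> Q" "l \<in> Q" "k \<noteq> l" "k \<notin> {s m, s n}" "l \<notin> {s m, s n}"
      using card_le_Suc0_iff_eq[of "Q - {s m, s n}"] finQ by auto
    have "E n m \<or> E n (s n)"
    proof (rule HVN[of k l])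
      show "E k l" using QE kl by blast
      show "E k m" "E l m" "E m (s n)" using s[OF mn(1)] s(1)[OF mn(2)] kl mn(3) sym by auto
      show "E k (s n)" "E l (s n)" using QE s(1)[OF mn(2)] kl by auto
      show "E n k" "E n l" using s(3)[OF mn(2)] kl by auto
      show "n \<noteq> s n" using nQ s(1)[OF mn(2)] by auto
    qed (rule nQ(2))
    then show False using s(2)[OF mn(2)] nE sym by blast
  qed
  obtain h where h: "bij_betw h Q {..<t}"
    using ex_bij_betw_finite_nat[OF finQ] Q(3) by (auto simp: atLeast0LessThan)
  define p where "p = (\<lambda>v. h (s v))"
  have p: "p m = p n \<longleftrightarrow> s m = s n" if "m \<in> M" "n \<in> M" for m n
    using h s(1)[OF that(1)] s(1)[OF that(2)] unfolding p_def bij_betw_def by (metis inj_onD)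
  have "p ` M = h ` (s ` M)" unfolding p_def by auto
  also have "s ` M = Q" using s(1) sQ by force
  finally have multi: "multipartite t M p"
    unfolding multipartite_def using p same diff h by (auto simp: bij_betw_def)
  show ?thesis
  proof (rule that[OF MU multi])
    fix b assume b: "b \<in> U - M"
    show "sees_one_part M p b"
      unfolding sees_one_part_def
    proof (intro ballI impI, rule ccontr)
      fix m n assume "m \<in> M" "n \<in> M" "E b m" "E b n" "p m \<noteq> p n"
      then obtain a where a: "a < t" "\<And>x. x \<in> M \<Longrightarrow> p x \<noteq> a \<Longrightarrow> E b x"
        using sees_all_but_one_part[OF multi t] b by blast
      have bQ: "b \<notin> Q" using b sQ by blast
      have one: "k = l" if "k \<in> Q" "l \<in> Q" "\<not> E b k" "\<not> E b l" for k l
        using a(2)[of k] a(2)[of l] p[of k l] sQ that by metis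
      have "\<exists>k\<in>Q. \<not> E b k"
      proof (rule ccontr)
        assume "\<not> ?thesis"
        then have "is_clique (insert b Q)" using is_clique_insert[OF Q(2)] by blast
        then show False using max[of "insert b Q"] bQ b Q finQ by auto
      qed
      then have "b \<in> M" unfolding M_def using one b by blast
      then show False using b by blast
    qed
  qed
qed

end

section \<open>Colouring around one or two complete multipartite graphs\<close>

locale split_graph = free_graph +
  fixes w :: nat and M :: "'a set" and p :: "'a \<Rightarrow> nat"
  assumes w: "4 \<le> w"
    and M: "multipartite w M p" and MV: "M \<subseteq> V"
    and one_part: "b \<in> V - M \<Longrightarrow> sees_one_part M p b"
    and clique_le: "Q \<subseteq> V \<Longrightarrow> is_clique Q \<Longrightarrow> card Q \<le> w"
begin

abbreviation \<pi> :: "'a \<Rightarrow> nat" where "\<pi> \<equiv> view w M p"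

lemma view_sees: "b \<in> V \<Longrightarrow> b \<notin> M \<Longrightarrow> m \<in> M \<Longrightarrow> E b m \<Longrightarrow> \<pi> b = p m"
  using view_eq[OF one_part] by blast

lemma view_sees': "b \<in> V \<Longrightarrow> b \<notin> M \<Longrightarrow> m \<in> M \<Longrightarrow> E m b \<Longrightarrow> \<pi> b = p m"
  using view_sees sym by blast

text \<open>Representatives of parts \<open>i\<close> and \<open>j\<close> form an edge, which every
  \<open>P4\<close> outside \<open>M\<close> has to touch.\<close>

lemma P4_view:
  assumes P4: "is_P4 a b c d" and "{a, b, c, d} \<subseteq> V - M" and ij: "i < w" "j < w" "i \<noteq> j"
  shows "\<exists>v\<in>{a, b, c, d}. \<pi> v \<in> {i, j}"
proof -
  obtain m n where mn: "m \<in> M" "p m = i" "n \<in> M" "p n = j"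
    using multipartite_rep[OF M ij(1)] multipartite_rep[OF M ij(2)] by metis
  then have "E m n" using multipartite_E[OF M] ij(3) by blast
  from P2_P4[OF P4 this] view_sees'[of _ m] view_sees'[of _ n] assms(2) mn
  show ?thesis by auto
qed

lemma colorable_views:
  assumes "S \<subseteq> V - M" "i < w" "j < w" "i \<noteq> j" "\<And>v. v \<in> S \<Longrightarrow> \<pi> v \<notin> {i, j}"
    and "\<And>Q. Q \<subseteq> S \<Longrightarrow> is_clique Q \<Longrightarrow> card Q \<le> k"
  shows "colorable S k"
proof (rule P4_free_colorable)
  show "finite S" using assms(1) finite_subset_V by blast
  show False if "a \<in> S" "b \<in> S" "c \<in> S" "d \<in> S" "is_P4 a b c d" for a b c d
    using P4_view[OF that(5) _ assms(2-4)] that assms(1,5) by blast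
qed (rule assms(6))

text \<open>Each class gets two colours of \<open>M\<close> and one fresh colour, \<open>w\<close>
  or \<open>Suc w\<close>, whence the clique bound 3. Vertices with view \<open>w\<close> see no
  part and may go into either class; this freedom is what later keeps the cliques small.\<close>

lemma colorable_pairing:
  assumes F: "F \<union> G = V - M" and i: "i < w" "j < w" "i \<noteq> j"
    and vF: "\<And>v. v \<in> F \<Longrightarrow> \<pi> v \<in> {i, j, w}" and vG: "\<And>v. v \<in> G \<Longrightarrow> \<pi> v \<notin> {i, j}"
    and cF: "\<And>Q. Q \<subseteq> F \<Longrightarrow> is_clique Q \<Longrightarrow> card Q \<le> 3"
    and cG: "\<And>Q. Q \<subseteq> G \<Longrightarrow> is_clique Q \<Longrightarrow> card Q \<le> 3"
  shows "colorable V (w + 2)"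
proof -
  obtain k where k: "k < w" "k \<noteq> i" "k \<noteq> j" using obtain_less_avoiding3[of w i j j] w by auto
  obtain l where l: "l < w" "l \<noteq> i" "l \<noteq> j" "l \<noteq> k" using obtain_less_avoiding3[of w i j k] w by auto
  have "colorable F 3"
    by (rule colorable_views[of F k l]) (use F vF k l cF in fastforce)+
  then obtain c where c: "\<And>v. v \<in> F \<Longrightarrow> c v \<in> {k, l, w}"
    "\<And>u v. u \<in> F \<Longrightarrow> v \<in> F \<Longrightarrow> E u v \<Longrightarrow> c u \<noteq> c v"
    using colorable_palette[of F 3 "{k, l, w}"] k l by (auto simp: card_insert_if)
  have "colorable G 3"
    by (rule colorable_views[of G i j]) (use F vG i cG in blast)+
  then obtain d where d: "\<And>v. v \<in> G \<Longrightarrow> d v \<in> {i, j, Suc w}"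
    "\<And>u v. u \<in> G \<Longrightarrow> v \<in> G \<Longrightarrow> E u v \<Longrightarrow> d u \<noteq> d v"
    using colorable_palette[of G 3 "{i, j, Suc w}"] i by (auto simp: card_insert_if)
  define f where "f = (\<lambda>v. if v \<in> M then p v else if v \<in> F then c v else d v)"
  have M_col: "f m \<noteq> f v" if m: "m \<in> M" and v: "v \<in> V" "v \<notin> M" and E: "E m v" for m v
  proof -
    have pm: "p m < w" "\<pi> v = p m" using multipartite_part[OF M m] view_sees'[OF v m E] by auto
    show ?thesis
    proof (cases "v \<in> F")
      case True
      then show ?thesis using vF[OF True] c(1)[OF True] pm m v k l unfolding f_def by auto
    next
      case False
      then have "v \<in> G" using F v by blast
      then show ?thesis using vG[of v] d(1)[of v] pm m v False unfolding f_def by auto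
    qed
  qed
  have "f u \<noteq> f v" if E: "E u v" and uv: "u \<in> V" "v \<in> V" for u v
  proof (cases "u \<in> M \<or> v \<in> M")
    case True
    then consider "u \<in> M" "v \<in> M" | "u \<in> M" "v \<notin> M" | "u \<notin> M" "v \<in> M" by blast
    then show ?thesis
    proof cases
      case 1 then show ?thesis using multipartite_E[OF M] E unfolding f_def by simp
    next
      case 2 then show ?thesis using M_col uv E by blast
    next
      case 3 then show ?thesis using M_col[of v u] uv sym[OF E] by metis
    qed
  next
    case False
    then have G: "u \<notin> F \<Longrightarrow> u \<in> G" "v \<notin> F \<Longrightarrow> v \<in> G" using uv F by blast+
    have "{k, l, w} \<inter> {i, j, Suc w} = {}" using i k l by auto
    then have cd: "c x \<noteq> d y" "d y \<noteq> c x" if "x \<in> F" "y \<in> G" for x y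
      unfolding disjoint_iff using c(1)[OF that(1)] d(1)[OF that(2)] by metis+
    have "f u = (if u \<in> F then c u else d u)" "f v = (if v \<in> F then c v else d v)"
      using False unfolding f_def by auto
    then show ?thesis using G cd[of u v] cd[of v u] c(2)[OF _ _ E] d(2)[OF _ _ E]
      by (cases "u \<in> F"; cases "v \<in> F") auto
  qed
  moreover have "f v < w + 2" if v: "v \<in> V" for v
  proof -
    consider "v \<in> M" | "v \<notin> M" "v \<in> F" | "v \<notin> M" "v \<notin> F" "v \<in> G" using v F by blast
    then show ?thesis
      using multipartite_part[OF M, of v] c(1)[of v] d(1)[of v] i k l unfolding f_def
      by cases auto
  qed
  ultimately show ?thesis unfolding colorable_def by blast
qed

end

section \<open>A second complete multipartite graph coloured along with the first\<close>

locale two_split_graph = split_graph +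
  fixes t :: nat and M' :: "'a set" and p' :: "'a \<Rightarrow> nat"
  assumes t: "4 \<le> t"
    and M': "multipartite t M' p'" and M'V: "M' \<subseteq> V - M"
    and one_part': "b \<in> V - M - M' \<Longrightarrow> sees_one_part M' p' b"
begin

abbreviation \<rho> :: "'a \<Rightarrow> nat" where "\<rho> \<equiv> view t M' p'"
abbreviation R :: "'a set" where "R \<equiv> V - M - M'"

lemma disjoint: "m \<in> M \<Longrightarrow> m \<notin> M'"
  using M'V by blast

lemma in_V: "m \<in> M \<Longrightarrow> m \<in> V" "d \<in> M' \<Longrightarrow> d \<in> V"
  using MV M'V by blast+

lemma view_R: "b \<in> R \<Longrightarrow> m \<in> M \<Longrightarrow> E b m \<Longrightarrow> \<pi> b = p m"
  using view_sees by blast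

lemma view_M': "d \<in> M' \<Longrightarrow> m \<in> M \<Longrightarrow> E m d \<Longrightarrow> \<pi> d = p m"
  using view_sees' M'V by blast

lemma view'_R: "b \<in> R \<Longrightarrow> d \<in> M' \<Longrightarrow> E b d \<Longrightarrow> \<rho> b = p' d"
  using view_eq[OF one_part'] by blast

lemma t_le_w: "t \<le> w"
proof -
  obtain d where "d \<in> M'" using multipartite_rep[OF M', of 0] t by auto
  from transversal_clique[OF M' this] obtain Q where "Q \<subseteq> M'" "is_clique Q" "card Q = t" by metis
  then show ?thesis using clique_le[of Q] M'V by blast
qed

text \<open>Part \<open>j\<close> of \<open>M'\<close> shares the colour of part \<open>j\<close> of
  \<open>M\<close>, with two exceptions: part \<open>a\<close> gets \<open>w\<close>, which is new
  to \<open>M\<close>, and part \<open>i\<close> takes the colour \<open>a\<close> thus freed. For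
  \<open>i < w\<close> no part of \<open>M'\<close> has colour \<open>i\<close>, so part
  \<open>i\<close> of \<open>M\<close> and part \<open>a\<close> of \<open>M'\<close> are free of
  conflicts.\<close>

definition recolor :: "nat \<Rightarrow> nat \<Rightarrow> nat \<Rightarrow> nat" where
  "recolor i a j = (if j = a then w else if j = i then a else j)"

lemma recolor_less: "a < t \<Longrightarrow> j < t \<Longrightarrow> recolor i a j < w + 1"
  using t_le_w unfolding recolor_def by auto

lemma recolor_inj: "a < t \<Longrightarrow> j < t \<Longrightarrow> k < t \<Longrightarrow> recolor i a j = recolor i a k \<Longrightarrow> j = k"
  using t_le_w unfolding recolor_def by (auto split: if_splits)

lemma recolor_proper:
  assumes "a < t" "m \<in> M" "d \<in> M'" "p m = i \<or> p' d = a"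
  shows "p m \<noteq> recolor i a (p' d)"
  using assms multipartite_part[OF M] multipartite_part[OF M'] unfolding recolor_def
  by (metis less_irrefl)

text \<open>The views agree once seeing no part is read as seeing part \<open>i\<close> of
  \<open>M\<close>, respectively part \<open>a\<close> of \<open>M'\<close>.\<close>

definition keyed :: "nat \<Rightarrow> nat \<Rightarrow> 'a \<Rightarrow> 'a \<Rightarrow> bool" where
  "keyed i a x y \<longleftrightarrow> (\<pi> x = \<pi> y \<or> {\<pi> x, \<pi> y} \<subseteq> {w, i}) \<and> (\<rho> x = \<rho> y \<or> {\<rho> x, \<rho> y} \<subseteq> {t, a})"

text \<open>If all edges between \<open>M\<close> and \<open>M'\<close> touch part \<open>i\<close> of \<open>M\<close> or part \<open>a\<close> of \<open>M'\<close>, then all parts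
  can be monochromatic with only \<open>w + 1\<close> colours. A component of \<open>R\<close> has only two forbidden colours
  when its edges are keyed, and it is \<open>P\<^sub>4\<close>-free.\<close>

lemma colorable_keyed:
  assumes a: "a < t"
    and edges: "\<And>m d. m \<in> M \<Longrightarrow> d \<in> M' \<Longrightarrow> E m d \<Longrightarrow> p m = i \<or> p' d = a"
    and keyed: "\<And>x y. x \<in> R \<Longrightarrow> y \<in> R \<Longrightarrow> E x y \<Longrightarrow> keyed i a x y"
  shows "colorable V (w + 2)"
proof -
  define \<alpha> where "\<alpha> = (\<lambda>v. if \<pi> v = w then i else \<pi> v)"
  define \<beta> where "\<beta> = (\<lambda>v. if \<rho> v = t then a else \<rho> v)"
  let ?f = "recolor i a"
  have "\<exists>c. (\<forall>v\<in>R. \<alpha> v = k \<longrightarrow> \<beta> v = l \<longrightarrow> c v \<in> {..<w + 2} - {k, ?f l}) \<and>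
    (\<forall>u\<in>R. \<forall>v\<in>R. \<alpha> u = k \<longrightarrow> \<beta> u = l \<longrightarrow> \<alpha> v = k \<longrightarrow> \<beta> v = l \<longrightarrow> E u v \<longrightarrow> c u \<noteq> (c v :: nat))"
    for k l
  proof -
    let ?S = "{v \<in> R. \<alpha> v = k \<and> \<beta> v = l}"
    obtain j1 where j1: "j1 < w" "j1 \<noteq> k" using obtain_less_avoiding3[of w k k k] w by auto
    obtain j2 where j2: "j2 < w" "j2 \<noteq> k" "j2 \<noteq> j1" using obtain_less_avoiding3[of w k j1 j1] w by auto
    \<comment> \<open>All views in this class are \<open>k\<close> or \<open>w\<close>, so parts
      \<open>j1\<close> and \<open>j2\<close> are unseen and P4-freeness applies.\<close>
    have "colorable ?S w"
    proof (rule colorable_views[of _ j1 j2])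
      show "\<pi> v \<notin> {j1, j2}" if "v \<in> ?S" for v
        using that j1 j2 unfolding \<alpha>_def by (auto split: if_splits)
      show "card Q \<le> w" if "Q \<subseteq> ?S" "is_clique Q" for Q
        using clique_le[of Q] that by blast
    qed (use j1 j2 in auto)
    moreover have "card {..<w + 2} - card {k, ?f l} \<le> card ({..<w + 2} - {k, ?f l})"
      by (rule diff_card_le_card_Diff) simp
    moreover have "card {k, ?f l} \<le> 2" by (simp add: card_insert_if)
    ultimately have S: "colorable ?S w" and L: "w \<le> card ({..<w + 2} - {k, ?f l})" by simp_all
    obtain c where "\<And>v. v \<in> ?S \<Longrightarrow> c v \<in> {..<w + 2} - {k, ?f l}"
      "\<And>u v. u \<in> ?S \<Longrightarrow> v \<in> ?S \<Longrightarrow> E u v \<Longrightarrow> c u \<noteq> (c v :: nat)"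
      using colorable_palette[OF S _ L] by (metis (no_types, lifting) finite_Diff finite_lessThan)
    then show ?thesis by (intro exI[of _ c]) blast
  qed
  then obtain C where C1: "\<And>v. v \<in> R \<Longrightarrow> C (\<alpha> v) (\<beta> v) v \<in> {..<w + 2} - {\<alpha> v, ?f (\<beta> v)}"
    and C2: "\<And>u v. u \<in> R \<Longrightarrow> v \<in> R \<Longrightarrow> \<alpha> u = \<alpha> v \<Longrightarrow> \<beta> u = \<beta> v \<Longrightarrow> E u v \<Longrightarrow>
      C (\<alpha> v) (\<beta> v) u \<noteq> (C (\<alpha> v) (\<beta> v) v :: nat)"
    by metis
  define c where "c = (\<lambda>v. if v \<in> M then p v else if v \<in> M' then ?f (p' v) else C (\<alpha> v) (\<beta> v) v)"
  have cM: "c m = p m" if "m \<in> M" for m using that unfolding c_def by simp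
  have cM': "c d = ?f (p' d)" if "d \<in> M'" for d using that disjoint unfolding c_def by auto
  have cR: "c v \<in> {..<w + 2} - {\<alpha> v, ?f (\<beta> v)}" if "v \<in> R" for v using that C1 unfolding c_def by auto
  have MM': "c m \<noteq> c d" if "m \<in> M" "d \<in> M'" "E m d" for m d
    using recolor_proper[OF a that(1,2) edges[OF that]] cM cM' that by auto
  have MR: "c v \<noteq> c m" if "m \<in> M" "v \<in> R" "E v m" for m v
  proof -
    have "\<pi> v = p m" using view_R that by blast
    then have "\<alpha> v = p m" using multipartite_part[OF M that(1)] unfolding \<alpha>_def by simp
    then show ?thesis using cR[OF that(2)] cM[OF that(1)] by auto
  qed
  have M'R: "c v \<noteq> c d" if "d \<in> M'" "v \<in> R" "E v d" for d v
  proof -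
    have "\<rho> v = p' d" using view'_R that by blast
    then have "\<beta> v = p' d" using multipartite_part[OF M' that(1)] unfolding \<beta>_def by simp
    then show ?thesis using cR[OF that(2)] cM'[OF that(1)] by auto
  qed
  have M'M': "c d \<noteq> c d'" if "d \<in> M'" "d' \<in> M'" "E d d'" for d d'
    using that multipartite_E[OF M'] multipartite_part[OF M'] recolor_inj[OF a] cM' by metis
  have MM: "c m \<noteq> c n" if "m \<in> M" "n \<in> M" "E m n" for m n
    using that multipartite_E[OF M] cM by auto
  have RR: "c u \<noteq> c v" if "u \<in> R" "v \<in> R" "E u v" for u v
  proof -
    have "\<alpha> u = \<alpha> v" "\<beta> u = \<beta> v" using keyed[OF that] unfolding keyed_def \<alpha>_def \<beta>_def by auto
    then show ?thesis using C2[OF that(1,2)] that unfolding c_def by auto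
  qed
  have "c u \<noteq> c v" if E: "E u v" and uv: "u \<in> V" "v \<in> V" for u v
  proof -
    have "u \<in> M \<or> u \<in> M' \<or> u \<in> R" "v \<in> M \<or> v \<in> M' \<or> v \<in> R" using uv by blast+
    then show ?thesis
      using MM MM' MR M'R M'M' RR E sym[OF E] by metis
  qed
  moreover have "c v < w + 2" if v: "v \<in> V" for v
  proof -
    consider "v \<in> M" | "v \<in> M'" | "v \<in> R" using v by blast
    then show ?thesis
    proof cases
      case 1 then show ?thesis using cM multipartite_part[OF M] by fastforce
    next
      case 2 then show ?thesis using cM'[OF 2] recolor_less[OF a multipartite_part[OF M' 2], of i] by simp
    next
      case 3 then show ?thesis using cR[OF 3] by auto
    qed
  qed
  ultimately show ?thesis unfolding colorable_def by blast
qed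

end

section \<open>Every vertex of \<open>M\<close> sees at most one part of \<open>M'\<close>\<close>

text \<open>The assumptions treat \<open>M\<close> and \<open>M'\<close> alike, with no comparison
  of \<open>w\<close> and \<open>t\<close>, so that every lemma can be reused with the roles
  exchanged through \<open>swapped\<close>.\<close>

locale symmetric_pair = free_graph +
  fixes w :: nat and M :: "'a set" and p :: "'a \<Rightarrow> nat" and t :: nat and M' :: "'a set" and p' :: "'a \<Rightarrow> nat"
  assumes w4: "4 \<le> w" and t4: "4 \<le> t"
    and multi: "multipartite w M p" and multi': "multipartite t M' p'"
    and MV: "M \<subseteq> V" and M'V: "M' \<subseteq> V" and disj: "M \<inter> M' = {}"
    and one: "b \<in> V - M \<Longrightarrow> sees_one_part M p b"
    and one': "b \<in> V - M' \<Longrightarrow> sees_one_part M' p' b"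
begin

lemma swapped: "symmetric_pair V E t M' p' w M p"
  by unfold_locales (use w4 t4 multi multi' MV M'V disj one one' in blast)+

abbreviation \<pi> :: "'a \<Rightarrow> nat" where "\<pi> \<equiv> view w M p"
abbreviation \<rho> :: "'a \<Rightarrow> nat" where "\<rho> \<equiv> view t M' p'"
abbreviation R :: "'a set" where "R \<equiv> V - M - M'"

lemma view_R: "b \<in> R \<Longrightarrow> m \<in> M \<Longrightarrow> E b m \<Longrightarrow> \<pi> b = p m"
  using view_eq[OF one] by blast

lemma view'_R: "b \<in> R \<Longrightarrow> d \<in> M' \<Longrightarrow> E b d \<Longrightarrow> \<rho> b = p' d"
  using view_eq[OF one'] by blast

lemma view_M': "m \<in> M \<Longrightarrow> d \<in> M' \<Longrightarrow> E m d \<Longrightarrow> \<pi> d = p m"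
  using view_eq[OF one] M'V disj sym by blast

lemma view'_M: "m \<in> M \<Longrightarrow> d \<in> M' \<Longrightarrow> E m d \<Longrightarrow> \<rho> m = p' d"
  using view_eq[OF one'] MV disj by blast

definition unseen_edge :: "'a \<Rightarrow> 'a \<Rightarrow> 'a \<Rightarrow> 'a \<Rightarrow> bool" where
  "unseen_edge x y m d \<longleftrightarrow> m \<in> M \<and> d \<in> M' \<and> E m d \<and> \<not> E x m \<and> \<not> E y m \<and> \<not> E x d \<and> \<not> E y d"

text \<open>Otherwise \<open>n m d f\<close> is a \<open>P4\<close> missed by the edge
  \<open>xy\<close>: \<open>d\<close> sees only the part of \<open>m\<close>, and \<open>m\<close>
  only the part of \<open>d\<close>, so \<open>nd\<close> and \<open>mf\<close> are
  non-edges.\<close>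

lemma unseen_edge_complete:
  assumes xy: "x \<in> R" "y \<in> R" "E x y" and e: "unseen_edge x y m d"
    and n: "n \<in> M" "p n \<noteq> p m" "\<not> E x n" "\<not> E y n"
    and f: "f \<in> M'" "p' f \<noteq> p' d" "\<not> E x f" "\<not> E y f"
  shows "E n f"
proof (rule ccontr)
  assume "\<not> E n f"
  moreover have "E n m" "E d f"
    using e n(1,2) f(1,2) multipartite_E[OF multi, of n m] multipartite_E[OF multi', of d f]
    unfolding unseen_edge_def by auto
  moreover have "\<not> E n d" using e n view_M'[of n d] view_M'[of m d] unfolding unseen_edge_def by metis
  moreover have "\<not> E m f" using e f view'_M[of m d] view'_M[of m f] unfolding unseen_edge_def by metis
  ultimately have "is_P4 n m d f" using e unfolding unseen_edge_def is_P4_def by blast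
  from P2_P4[OF this xy(3)] show False using e n f unfolding unseen_edge_def by blast
qed

text \<open>A vertex \<open>n\<close> in a free part of \<open>M\<close> would see every free part
  of \<open>M'\<close>, but it sees only one.\<close>

lemma unseen_edge_views':
  assumes xy: "x \<in> R" "y \<in> R" "E x y" and e: "unseen_edge x y m d"
  shows "t = 4 \<and> p' d < t \<and> \<rho> x < t \<and> \<rho> y < t \<and> p' d \<noteq> \<rho> x \<and> p' d \<noteq> \<rho> y \<and> \<rho> x \<noteq> \<rho> y"
proof (rule three_distinct_if_at_most_one_avoids[OF t4])
  fix i j assume ij: "i < t" "j < t" "i \<notin> {p' d, \<rho> x, \<rho> y}" "j \<notin> {p' d, \<rho> x, \<rho> y}"
  obtain k where k: "k < w" "k \<noteq> p m" "k \<noteq> \<pi> x" "k \<noteq> \<pi> y"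
    using obtain_less_avoiding3[of w "p m" "\<pi> x" "\<pi> y"] w4 by auto
  obtain n where n: "n \<in> M" "p n = k" using multipartite_rep[OF multi k(1)] .
  obtain f where f: "f \<in> M'" "p' f = i" using multipartite_rep[OF multi' ij(1)] .
  obtain g where g: "g \<in> M'" "p' g = j" using multipartite_rep[OF multi' ij(2)] .
  have n': "\<not> E x n" "\<not> E y n" "p n \<noteq> p m" using view_R xy n k by metis+
  have "\<not> E x f" "\<not> E y f" "\<not> E x g" "\<not> E y g" using view'_R xy f g ij by auto
  then have "E n f" "E n g"
    using unseen_edge_complete[OF xy e n(1) n'(3,1,2)] f g ij by auto
  then show "i = j" using view'_M[OF n(1)] f g by metis
qed

text \<open>The path \<open>y x m n\<close>, with \<open>n\<close> in a free part of
  \<open>M\<close>, must touch an edge between two free parts of \<open>M'\<close>. It can do so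
  only at \<open>n\<close>, which would produce an unseen edge.\<close>

lemma private_neighbour_views':
  assumes xy: "x \<in> R" "y \<in> R" "E x y" and no: "\<And>m d. \<not> unseen_edge x y m d"
    and m: "m \<in> M" "E x m" "\<not> E y m"
  shows "t = 4 \<and> \<rho> x < t \<and> \<rho> y < t \<and> \<rho> m < t \<and> \<rho> x \<noteq> \<rho> y \<and> \<rho> x \<noteq> \<rho> m \<and> \<rho> y \<noteq> \<rho> m"
proof (rule three_distinct_if_at_most_one_avoids[OF t4], rule ccontr)
  fix i j assume ij: "i < t" "j < t" "i \<notin> {\<rho> x, \<rho> y, \<rho> m}" "j \<notin> {\<rho> x, \<rho> y, \<rho> m}" "i \<noteq> j"
  obtain k where k: "k < w" "k \<noteq> p m" "k \<noteq> \<pi> y"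
    using obtain_less_avoiding3[of w "p m" "\<pi> y" "\<pi> y"] w4 by auto
  obtain n where n: "n \<in> M" "p n = k" using multipartite_rep[OF multi k(1)] .
  obtain f where f: "f \<in> M'" "p' f = i" using multipartite_rep[OF multi' ij(1)] .
  obtain g where g: "g \<in> M'" "p' g = j" using multipartite_rep[OF multi' ij(2)] .
  have px: "\<pi> x = p m" using view_R xy m by blast
  have n': "\<not> E x n" "\<not> E y n" "E m n"
    using view_R[OF xy(1), of n] view_R[OF xy(2), of n] multipartite_E[OF multi, of m n] px m n k by auto
  have fg: "\<not> E x f" "\<not> E y f" "\<not> E x g" "\<not> E y g" "\<not> E m f" "\<not> E m g" "E f g"
    using view'_R xy view'_M[OF m(1)] multipartite_E[OF multi'] f g ij by auto
  have "is_P4 y x m n" unfolding is_P4_def using n' xy(3) m sym by blast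
  from P2_P4[OF this fg(7)] have "E n f \<or> E n g" using fg sym by blast
  then show False using no[of n f] no[of n g] n n' fg f g unfolding unseen_edge_def by blast
qed

definition parallel :: "'a \<Rightarrow> 'a \<Rightarrow> bool" where
  "parallel x y \<longleftrightarrow> (\<forall>m\<in>M \<union> M'. E x m \<longleftrightarrow> E y m)"

lemma parallel_views:
  assumes "parallel x y" shows "\<pi> x = \<pi> y" "\<rho> x = \<rho> y"
proof -
  have "(\<lambda>m. m \<in> M \<and> E x m) = (\<lambda>m. m \<in> M \<and> E y m)" "(\<lambda>m. m \<in> M' \<and> E x m) = (\<lambda>m. m \<in> M' \<and> E y m)"
    using assms unfolding parallel_def by auto
  then show "\<pi> x = \<pi> y" "\<rho> x = \<rho> y" unfolding view_def Bex_def by auto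
qed

text \<open>This permits splitting \<open>M'\<close> between the two classes of
  \<open>colorable_pairing\<close>: part \<open>b\<close> can join the views \<open>i\<close> and
  \<open>j\<close>, part \<open>a\<close> stays on the other side, and so each class misses a part
  of \<open>M'\<close>.\<close>

definition separated :: "nat \<Rightarrow> nat \<Rightarrow> nat \<Rightarrow> nat \<Rightarrow> bool" where
  "separated i j a b \<longleftrightarrow> a < t \<and> b < t \<and> a \<noteq> b \<and>
    (\<forall>d\<in>M'. \<forall>m\<in>M. E m d \<longrightarrow> (p' d = a \<longrightarrow> p m \<notin> {i, j}) \<and> (p' d = b \<longrightarrow> p m \<in> {i, j}))"

text \<open>The property that no end of a parallel edge can have; see
  \<open>parallel_touches\<close>.\<close>

definition escapes :: "'a \<Rightarrow> bool" where
  "escapes x \<longleftrightarrow> (\<exists>m\<in>M. \<exists>d\<in>M'. E m d \<and> p m \<noteq> \<pi> x \<and> p' d \<noteq> \<rho> x)"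

text \<open>Both sides have four parts, two of them unseen by \<open>x\<close> and \<open>y\<close>.
  These unseen parts are joined in pairs: \<open>p m\<close> with \<open>p' d\<close>, and the
  fourth parts \<open>k\<close> with \<open>l\<close>. Hence \<open>p' d\<close> serves as
  \<open>a\<close>, and \<open>\<rho> x\<close>, which receives no edge from the unseen parts of
  \<open>M\<close>, serves as \<open>b\<close>.\<close>

lemma unseen_edge_structure:
  assumes xy: "x \<in> R" "y \<in> R" "E x y" and e: "unseen_edge x y m d"
  shows "w = 4 \<and> t = 4 \<and> \<pi> x < w \<and> \<pi> y < w \<and> \<pi> x \<noteq> \<pi> y \<and> \<rho> x < t \<and> \<rho> y < t \<and> \<rho> x \<noteq> \<rho> y \<and>
    (\<exists>a b. separated (\<pi> x) (\<pi> y) a b) \<and> escapes x \<and> escapes y"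
proof -
  interpret sw: symmetric_pair V E t M' p' w M p by (rule swapped)
  have "sw.unseen_edge x y d m" using e sym unfolding unseen_edge_def sw.unseen_edge_def by blast
  from sw.unseen_edge_views'[OF _ _ xy(3) this] xy
  have W: "w = 4" "p m < w" "\<pi> x < w" "\<pi> y < w" "p m \<noteq> \<pi> x" "p m \<noteq> \<pi> y" "\<pi> x \<noteq> \<pi> y" by auto
  from unseen_edge_views'[OF xy e]
  have T: "t = 4" "p' d < t" "\<rho> x < t" "\<rho> y < t" "p' d \<noteq> \<rho> x" "p' d \<noteq> \<rho> y" "\<rho> x \<noteq> \<rho> y" by auto
  have e': "m \<in> M" "d \<in> M'" "E m d" using e unfolding unseen_edge_def by auto
  have unM: "\<not> E x n" "\<not> E y n" if "n \<in> M" "p n \<notin> {\<pi> x, \<pi> y}" for n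
    using view_R xy that by auto
  have unM': "\<not> E x f" "\<not> E y f" if "f \<in> M'" "p' f \<notin> {\<rho> x, \<rho> y}" for f
    using view'_R xy that by auto
  obtain k where k: "k < w" "k \<noteq> p m" "k \<noteq> \<pi> x" "k \<noteq> \<pi> y"
    using obtain_less_avoiding3[of w "p m" "\<pi> x" "\<pi> y"] w4 by auto
  obtain l where l: "l < t" "l \<noteq> p' d" "l \<noteq> \<rho> x" "l \<noteq> \<rho> y"
    using obtain_less_avoiding3[of t "p' d" "\<rho> x" "\<rho> y"] t4 by auto
  obtain n where n: "n \<in> M" "p n = k" using multipartite_rep[OF multi k(1)] .
  obtain f where f: "f \<in> M'" "p' f = l" using multipartite_rep[OF multi' l(1)] .
  \<comment> \<open>A second unseen edge between the fourth parts, so that completeness can also be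
    applied to \<open>p m\<close> and \<open>p' d\<close> themselves.\<close>
  have e2: "unseen_edge x y n f"
    using unseen_edge_complete[OF xy e, of n f] unM[of n] unM'[of f] n f k l unfolding unseen_edge_def by auto
  have far: "\<rho> u \<notin> {\<rho> x, \<rho> y}" if u: "u \<in> M" "p u \<notin> {\<pi> x, \<pi> y}" for u
  proof (cases "p u = p m")
    case True
    then have "E u d" using unseen_edge_complete[OF xy e2, of u d] u unM[of u] unM'[of d] e' n f k l T by auto
    then show ?thesis using view'_M[OF u(1) e'(2)] T by auto
  next
    case False
    then have "E u f" using unseen_edge_complete[OF xy e, of u f] u unM[of u] unM'[of f] f l by auto
    then show ?thesis using view'_M[OF u(1) f(1)] f l by auto
  qed
  have "separated (\<pi> x) (\<pi> y) (p' d) (\<rho> x)"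
    unfolding separated_def
  proof (intro conjI ballI impI)
    fix f' u assume fu: "f' \<in> M'" "u \<in> M" "E u f'"
    show "p u \<notin> {\<pi> x, \<pi> y}" if "p' f' = p' d"
    proof -
      have "E m f'" using unseen_edge_complete[OF xy e2, of m f'] that fu e' unM[of m] unM'[of f'] W T n f k l by auto
      then show ?thesis using view_M'[OF fu(2,1,3)] view_M'[OF e'(1) fu(1)] W by auto
    qed
    show "p u \<in> {\<pi> x, \<pi> y}" if "p' f' = \<rho> x"
      using far[OF fu(2)] view'_M[OF fu(2,1,3)] that by auto
  qed (use T in auto)
  moreover have "escapes x" "escapes y" unfolding escapes_def using e' W T by metis+
  ultimately show ?thesis using W T by blast
qed

text \<open>Without an unseen edge, a vertex of \<open>M\<close> telling \<open>x\<close> and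
  \<open>y\<close> apart forces distinct views into \<open>M'\<close>. Then some vertex of
  \<open>M'\<close> tells them apart as well, and the exchanged lemma fixes the views into
  \<open>M\<close>.\<close>

lemma nonparallel_structure:
  assumes xy: "x \<in> R" "y \<in> R" "E x y" and np: "\<not> parallel x y"
  shows "w = 4 \<and> t = 4 \<and> \<pi> x < w \<and> \<pi> y < w \<and> \<pi> x \<noteq> \<pi> y \<and> \<rho> x < t \<and> \<rho> y < t \<and> \<rho> x \<noteq> \<rho> y \<and>
    (\<exists>a b. separated (\<pi> x) (\<pi> y) a b) \<and> escapes x \<and> escapes y"
proof (cases "\<exists>m d. unseen_edge x y m d")
  case True
  then show ?thesis using unseen_edge_structure[OF xy] by blast
next
  case False
  interpret sw: symmetric_pair V E t M' p' w M p by (rule swapped)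
  have no: "\<not> unseen_edge x y m d" "\<not> unseen_edge y x m d" for m d
    using False unfolding unseen_edge_def by blast+
  have no': "\<not> sw.unseen_edge x y m d" "\<not> sw.unseen_edge y x m d" for m d
    using False sym unfolding unseen_edge_def sw.unseen_edge_def by blast+
  have yx: "E y x" using sym xy(3) .
  have xyR: "x \<in> V - M' - M" "y \<in> V - M' - M" using xy by auto
  have m: "t = 4 \<and> \<rho> x < t \<and> \<rho> y < t \<and> \<rho> x \<noteq> \<rho> y \<and> \<rho> m < t \<and> \<rho> m \<notin> {\<rho> x, \<rho> y}"
    if "m \<in> M" "E x m \<noteq> E y m" for m
    using that private_neighbour_views'[OF xy no(1), of m] private_neighbour_views'[OF xy(2,1) yx no(2), of m]
    by auto
  have d: "w = 4 \<and> \<pi> x < w \<and> \<pi> y < w \<and> \<pi> x \<noteq> \<pi> y \<and> \<pi> d < w \<and> \<pi> d \<notin> {\<pi> x, \<pi> y}"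
    if "d \<in> M'" "E x d \<noteq> E y d" for d
    using that sw.private_neighbour_views'[OF xyR xy(3) no'(1), of d]
      sw.private_neighbour_views'[OF xyR(2,1) yx no'(2), of d]
    by auto
  have split': "\<exists>d\<in>M'. E x d \<noteq> E y d" if "\<rho> x < t" "\<rho> x \<noteq> \<rho> y"
    using view_less[OF that(1)] view'_R[OF xy(1)] view'_R[OF xy(2)] that(2) by metis
  have split: "\<exists>m\<in>M. E x m \<noteq> E y m" if "\<pi> x < w" "\<pi> x \<noteq> \<pi> y"
    using view_less[OF that(1)] view_R[OF xy(1)] view_R[OF xy(2)] that(2) by metis
  from np consider m where "m \<in> M" "E x m \<noteq> E y m" | d where "d \<in> M'" "E x d \<noteq> E y d"
    unfolding parallel_def by auto
  then have both: "\<exists>m\<in>M. E x m \<noteq> E y m" "\<exists>d\<in>M'. E x d \<noteq> E y d"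
    using m d split split' by metis+
  then have W: "w = 4" "\<pi> x < w" "\<pi> y < w" "\<pi> x \<noteq> \<pi> y" and T: "t = 4" "\<rho> x < t" "\<rho> y < t" "\<rho> x \<noteq> \<rho> y"
    using m d by metis+
  have mm: "\<rho> u < t \<and> \<rho> u \<notin> {\<rho> x, \<rho> y}" if "u \<in> M" "E x u \<or> E y u" for u
    using m[of u] that view_R[OF xy(1) that(1)] view_R[OF xy(2) that(1)] W by metis
  have dd: "\<pi> u < w \<and> \<pi> u \<notin> {\<pi> x, \<pi> y}" if "u \<in> M'" "E x u \<or> E y u" for u
    using d[of u] that view'_R[OF xy(1) that(1)] view'_R[OF xy(2) that(1)] T by metis
  have esc: "\<exists>u\<in>M. \<exists>d\<in>M'. E u d \<and> p u = \<pi> z \<and> p' d \<notin> {\<rho> x, \<rho> y}" if z: "z \<in> {x, y}" for z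
  proof -
    have "\<pi> z < w" using z W by auto
    then obtain u where u: "u \<in> M" "E z u" using view_less by blast
    then have u2: "\<rho> u < t" "\<rho> u \<notin> {\<rho> x, \<rho> y}" using mm[of u] z by auto
    then obtain d where d: "d \<in> M'" "E u d" using view_less by blast
    have "p u = \<pi> z" using u view_R[of z u] z xy by auto
    moreover have "p' d \<notin> {\<rho> x, \<rho> y}" using u2(2) view'_M[OF u(1) d] by simp
    ultimately show ?thesis using u(1) d by blast
  qed
  \<comment> \<open>Every edge between \<open>M\<close> and \<open>M'\<close> is touched by
    \<open>x\<close> or \<open>y\<close>. Part \<open>b\<close> is seen by neither, so the end in
    \<open>M\<close> must be the one that is seen.\<close>
  obtain b where b: "b < t" "b \<noteq> \<rho> x" "b \<noteq> \<rho> y"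
    using obtain_less_avoiding3[of t "\<rho> x" "\<rho> y" "\<rho> y"] t4 by auto
  have "separated (\<pi> x) (\<pi> y) (\<rho> x) b"
    unfolding separated_def
  proof (intro conjI ballI impI)
    fix f u assume fu: "f \<in> M'" "u \<in> M" "E u f"
    then have v: "\<pi> f = p u" "\<rho> u = p' f" using view_M' view'_M by blast+
    have touch: "E x u \<or> E y u \<or> E x f \<or> E y f" using no(1)[of u f] fu unfolding unseen_edge_def by blast
    show "p u \<notin> {\<pi> x, \<pi> y}" if "p' f = \<rho> x"
      using touch mm[OF fu(2)] dd[OF fu(1)] v that by auto
    show "p u \<in> {\<pi> x, \<pi> y}" if "p' f = b"
    proof (rule ccontr)
      assume "\<not> ?thesis"
      then show False using touch view_R[OF xy(1) fu(2)] view_R[OF xy(2) fu(2)]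
          view'_R[OF xy(1) fu(1)] view'_R[OF xy(2) fu(1)] that b by auto
    qed
  qed (use T b in auto)
  moreover have "escapes x" "escapes y"
    unfolding escapes_def using esc[of x] esc[of y] W by auto metis+
  ultimately show ?thesis using W T by blast
qed

text \<open>An unseen edge would force \<rho> x and \<rho> y to differ, so \<open>x\<close> sees an
  end of every edge between \<open>M\<close> and \<open>M'\<close>.\<close>

lemma parallel_touches:
  assumes xy: "x \<in> R" "y \<in> R" "E x y" and par: "parallel x y" and md: "m \<in> M" "d \<in> M'" "E m d"
  shows "p m = \<pi> x \<or> p' d = \<rho> x"
proof -
  have "\<not> unseen_edge x y m d"
    using unseen_edge_views'[OF xy] parallel_views[OF par] by metis
  then have "E x m \<or> E x d" using md par unfolding unseen_edge_def parallel_def by blast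
  then show ?thesis using view_R[OF xy(1) md(1)] view'_R[OF xy(1) md(2)] by auto
qed

text \<open>Both ends of a non-parallel edge escape, while nothing parallel to \<open>x\<close>
  does. A path \<open>r s m n\<close> through the non-parallel edge must be touched by
  \<open>xy\<close> at \<open>s\<close> or \<open>r\<close>; the touching edge is then parallel and
  makes an escaping vertex parallel to \<open>x\<close>.\<close>

lemma all_parallel:
  assumes xy: "x \<in> R" "y \<in> R" "E x y" and par: "parallel x y"
    and uv: "u \<in> R" "v \<in> R" "E u v"
  shows "parallel u v"
proof (rule ccontr)
  have no_esc: "\<not> escapes z" if "parallel x z" for z
    using parallel_touches[OF xy par] parallel_views[OF that] unfolding escapes_def by metis
  assume np: "\<not> parallel u v"
  note uv_str = nonparallel_structure[OF uv np]
  obtain s r where sr: "{s, r} = {u, v}" "\<pi> s \<noteq> \<pi> x" using uv_str by (metis insert_commute)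
  then have sr': "s \<in> R" "r \<in> R" "E s r" "\<pi> s < w" "\<pi> s \<noteq> \<pi> r"
    using uv uv_str sym by (auto simp: doubleton_eq_iff)
  obtain m where m: "m \<in> M" "E s m" using view_less[OF sr'(4)] .
  have pm: "p m = \<pi> s" using view_R sr'(1) m by metis
  obtain k where k: "k < w" "k \<noteq> \<pi> x" "k \<noteq> \<pi> s" "k \<noteq> \<pi> r"
    using obtain_less_avoiding3[of w "\<pi> x" "\<pi> s" "\<pi> r"] w4 by auto
  obtain n where n: "n \<in> M" "p n = k" using multipartite_rep[OF multi k(1)] .
  have "is_P4 r s m n"
    unfolding is_P4_def
    using m n k pm sr' sym view_R[OF sr'(2), of m] view_R[OF sr'(2), of n] view_R[OF sr'(1), of n]
      multipartite_E[OF multi, of m n] by metis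
  from P2_P4[OF this xy(3)] obtain z q where zq: "z \<in> {x, y}" "q \<in> {s, r}" "E z q"
    using view_R[OF xy(1), of m] view_R[OF xy(2), of m] view_R[OF xy(1), of n] view_R[OF xy(2), of n]
      parallel_views(1)[OF par] m n pm sr(2) k by (metis insertI1 insertI2 singletonI)
  have xz: "parallel x z" using zq(1) par unfolding parallel_def by auto
  have q: "q \<in> R" "escapes q" using zq(2) sr' sr(1) uv_str by (auto simp: doubleton_eq_iff)
  have "z \<in> R" using zq(1) xy by auto
  then have "parallel z q"
    using nonparallel_structure[OF _ q(1) zq(3)] no_esc[OF xz] by blast
  then have "parallel x q" using xz unfolding parallel_def by auto
  then show False using no_esc q(2) by blast
qed

end

section \<open>Colourings when the two multipartite graphs see at most one part of each
  other\<close>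

locale type_one_graph = two_split_graph +
  assumes one_part_M: "m \<in> M \<Longrightarrow> sees_one_part M' p' m"
begin

sublocale pair: symmetric_pair V E w M p t M' p'
proof unfold_locales
  show "sees_one_part M' p' b" if "b \<in> V - M'" for b
    using that one_part' one_part_M by blast
  show "M' \<subseteq> V" "M \<inter> M' = {}" using M'V by blast+
qed (use w t M M' MV one_part in auto)

lemma colorable_parallel:
  assumes xy: "x \<in> R" "y \<in> R" "E x y" and par: "pair.parallel x y"
  shows "colorable V (w + 2)"
proof (rule colorable_keyed)
  \<comment> \<open>If \<open>x\<close> sees nothing of \<open>M'\<close>, then all edges between
    \<open>M\<close> and \<open>M'\<close> touch part \<open>\<pi> x\<close>, and 0 is an arbitrary
    choice.\<close>
  let ?a = "if \<rho> x < t then \<rho> x else 0"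
  show "?a < t" using t by auto
  show "p m = \<pi> x \<or> p' d = ?a" if "m \<in> M" "d \<in> M'" "E m d" for m d
    using pair.parallel_touches[OF xy par that] multipartite_part[OF M' that(2)] by auto
  show "keyed (\<pi> x) ?a u v" if "u \<in> R" "v \<in> R" "E u v" for u v
    using pair.parallel_views[OF pair.all_parallel[OF xy par that]] unfolding keyed_def by blast
qed

lemma colorable_nonparallel:
  assumes xy: "x \<in> R" "y \<in> R" "E x y"
    and np: "\<And>u v. u \<in> R \<Longrightarrow> v \<in> R \<Longrightarrow> E u v \<Longrightarrow> \<not> pair.parallel u v"
  shows "colorable V (w + 2)"
proof -
  note str = pair.nonparallel_structure[OF xy np[OF xy]]
  obtain a b where "pair.separated (\<pi> x) (\<pi> y) a b" using str by blast
  then have ab: "a < t" "b < t" "a \<noteq> b" "\<And>d m. d \<in> M' \<Longrightarrow> m \<in> M \<Longrightarrow> E m d \<Longrightarrow> p' d = a \<Longrightarrow> p m \<notin> {\<pi> x, \<pi> y}"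
    "\<And>d m. d \<in> M' \<Longrightarrow> m \<in> M \<Longrightarrow> E m d \<Longrightarrow> p' d = b \<Longrightarrow> p m \<in> {\<pi> x, \<pi> y}"
    unfolding pair.separated_def by blast+
  \<comment> \<open>Adjacent vertices of \<open>R\<close> have different views in a set of size two,
    so \<open>Q\<close> has at most two vertices in \<open>R\<close>. Two vertices in
    \<open>M'\<close> already force \<open>Q\<close> into \<open>M'\<close>, where it misses part
    \<open>c\<close> of the four parts.\<close>
  have small: "card Q \<le> 3"
    if Q: "Q \<subseteq> V - M" "is_clique Q" and c: "c < t" "\<And>v. v \<in> Q \<inter> M' \<Longrightarrow> p' v \<noteq> c"
      and A: "card A \<le> 2" "finite A" "\<And>v. v \<in> Q \<Longrightarrow> \<pi> v < w \<Longrightarrow> \<pi> v \<in> A" for Q c A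
  proof -
    have fin: "finite Q" using Q(1) finite_subset_V by blast
    have two: "card (Q - M') \<le> 2"
    proof (cases "card (Q - M') \<le> Suc 0")
      case False
      have view: "\<pi> u < w \<and> \<pi> v < w \<and> \<pi> u \<noteq> \<pi> v" if uv: "u \<in> Q - M'" "v \<in> Q - M'" "u \<noteq> v" for u v
      proof -
        have "E u v" using uv Q(2) unfolding is_clique_def by blast
        moreover have "u \<in> R" "v \<in> R" using uv Q(1) by blast+
        ultimately show ?thesis using pair.nonparallel_structure[OF _ _ _ np] by blast
      qed
      have "\<exists>v\<in>Q - M'. v \<noteq> u" if "u \<in> Q - M'" for u
        using False that fin by (metis card_le_Suc0_iff_eq finite_Diff)
      then have "\<pi> ` (Q - M') \<subseteq> A" using view A(3) by blast
      moreover have "inj_on \<pi> (Q - M')" by (rule inj_onI) (use view in metis)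
      ultimately have "card (Q - M') \<le> card A" using card_inj_on_le A(2) by blast
      then show ?thesis using A(1) by simp
    qed auto
    have split: "card Q = card (Q \<inter> M') + card (Q - M')"
      using card_Int_Diff[OF fin] .
    show ?thesis
    proof (cases "card (Q \<inter> M') \<le> Suc 0")
      case True
      then show ?thesis using two split by simp
    next
      case False
      then obtain d e where de: "d \<in> Q \<inter> M'" "e \<in> Q \<inter> M'" "d \<noteq> e"
        using card_le_Suc0_iff_eq[of "Q \<inter> M'"] fin by auto
      then have "E d e" using Q(2) unfolding is_clique_def by blast
      then have "p' d \<noteq> p' e" using multipartite_E[OF M'] de by blast
      have "Q \<subseteq> M'"
      proof
        fix v assume v: "v \<in> Q"
        show "v \<in> M'"
        proof (rule ccontr)
          assume "v \<notin> M'"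
          then have "v \<in> R" "v \<noteq> d" "v \<noteq> e" using v Q(1) de by blast+
          moreover from this have "E v d" "E v e" using v Q(2) de unfolding is_clique_def by simp_all
          ultimately show False using view'_R[of v d] view'_R[of v e] de \<open>p' d \<noteq> p' e\<close> by simp
        qed
      qed
      have "inj_on p' Q"
      proof (rule inj_onI, rule ccontr)
        fix u v assume uv: "u \<in> Q" "v \<in> Q" "p' u = p' v" "u \<noteq> v"
        then have "E u v" using Q(2) unfolding is_clique_def by blast
        then show False using multipartite_E[OF M', of u v] uv \<open>Q \<subseteq> M'\<close> by blast
      qed
      moreover have "p' ` Q \<subseteq> {..<t} - {c}" using \<open>Q \<subseteq> M'\<close> c multipartite_part[OF M'] by auto
      ultimately have "card Q \<le> card ({..<t} - {c})" using card_inj_on_le by blast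
      then show ?thesis using str c by simp
    qed
  qed
  \<comment> \<open>Part \<open>b\<close> sees only \<open>\<pi> x\<close>, \<open>\<pi> y\<close>
    or nothing. Moving all of it to \<open>?F\<close> frees the other class of part
    \<open>b\<close>, while \<open>?F\<close> itself misses part \<open>a\<close>.\<close>
  let ?F = "{v \<in> V - M. \<pi> v \<in> {\<pi> x, \<pi> y} \<or> v \<in> M' \<and> p' v = b}"
  have b_view: "\<pi> v \<in> {\<pi> x, \<pi> y, w}" if "v \<in> M'" "p' v = b" for v
  proof (cases "\<pi> v < w")
    case True
    then obtain m where m: "m \<in> M" "E v m" using view_less by blast
    then show ?thesis using ab(5)[OF that(1) m(1)] view_M'[OF that(1) m(1)] that(2) sym by auto
  next
    case False
    then show ?thesis using view_le[OF M, of v] by auto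
  qed
  have a_view: "\<pi> v \<notin> {\<pi> x, \<pi> y}" if "v \<in> M'" "p' v = a" for v
  proof
    assume view: "\<pi> v \<in> {\<pi> x, \<pi> y}"
    then have "\<pi> v < w" using str by auto
    then obtain m where m: "m \<in> M" "E v m" using view_less by blast
    then show False using ab(4)[OF that(1) m(1)] view_M'[OF that(1) m(1)] view that(2) sym by auto
  qed
  show ?thesis
  proof (rule colorable_pairing[of ?F "V - M - ?F" "\<pi> x" "\<pi> y"])
    show "\<pi> v \<in> {\<pi> x, \<pi> y, w}" if "v \<in> ?F" for v using that b_view by auto
    show "card Q \<le> 3" if "Q \<subseteq> ?F" "is_clique Q" for Q
    proof (rule small[of Q a "{\<pi> x, \<pi> y}"])
      show "p' v \<noteq> a" if "v \<in> Q \<inter> M'" for v using that \<open>Q \<subseteq> ?F\<close> a_view ab(3) by auto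
      show "\<pi> v \<in> {\<pi> x, \<pi> y}" if "v \<in> Q" "\<pi> v < w" for v using that \<open>Q \<subseteq> ?F\<close> b_view by fastforce
    qed (use that ab in \<open>auto simp: card_insert_if\<close>)
    show "card Q \<le> 3" if "Q \<subseteq> V - M - ?F" "is_clique Q" for Q
    proof (rule small[of Q b "{..<w} - {\<pi> x, \<pi> y}"])
      have "card ({..<w} - {\<pi> x, \<pi> y}) = card {..<w} - card {\<pi> x, \<pi> y}"
        by (rule card_Diff_subset) (use str in auto)
      also have "card {\<pi> x, \<pi> y} = 2" by (rule card_2_iff[THEN iffD2]) (use str in blast)
      also have "card {..<w} - 2 = w - 2" by simp
      also have "\<dots> = 2" using str by linarith
      finally show "card ({..<w} - {\<pi> x, \<pi> y}) \<le> 2" by simp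
      show "p' v \<noteq> b" if "v \<in> Q \<inter> M'" for v using that \<open>Q \<subseteq> V - M - ?F\<close> by auto
      show "\<pi> v \<in> {..<w} - {\<pi> x, \<pi> y}" if "v \<in> Q" "\<pi> v < w" for v using that \<open>Q \<subseteq> V - M - ?F\<close> by auto
    qed (use that ab in auto)
  qed (use str in auto)
qed

end

context type_one_graph begin

text \<open>The first \<open>w - e\<close> parts of \<open>M\<close> and of \<open>M'\<close> are monochromatic, with disjoint sets of colours;
  each of the other parts has a default colour and a second one, for the vertices that see the
  part of the other side owning the default colour.\<close>

lemma colorable_independent_rest:
  assumes e: "w \<le> 3 * e" "2 * e \<le> w"
    and ind: "\<And>u v. u \<in> R \<Longrightarrow> v \<in> R \<Longrightarrow> \<not> E u v"
  shows "colorable V (w + e)"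
proof -
  define r where "r = w - e"
  have r: "w = r + e" "e \<le> r" "r \<le> 2 * e" using e unfolding r_def by auto
  \<comment> \<open>For \<open>r \<le> i\<close> the default \<open>i\<close> is the colour of part
    \<open>i - r\<close> of \<open>M'\<close>. The fallback \<open>i + e\<close> goes to vertices
    seeing only that part, so it merely has to be new within \<open>M\<close>.\<close>
  define g where "g = (\<lambda>i j. if r \<le> i \<and> j = i - r then i + e else i)"
  \<comment> \<open>The fallback \<open>j - r + e\<close> may be the colour of a part of
    \<open>M\<close> that the vertex does not see. Once it reaches \<open>r\<close>, it would
    collide with \<open>M'\<close> itself; \<open>j + e\<close> is then at least
    \<open>2 * r\<close>, past those colours.\<close>
  define h where "h = (\<lambda>j i. if j < r then r + j else if i \<noteq> j - r then j - r
    else if j - r + e < r then j - r + e else j + e)"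
  define c where "c = (\<lambda>v. if v \<in> M then g (p v) (\<rho> v) else h (p' v) (\<pi> v))"
  have cM: "c m = g (p m) (\<rho> m)" if "m \<in> M" for m using that unfolding c_def by simp
  have cM': "c d = h (p' d) (\<pi> d)" if "d \<in> M'" for d using that disjoint unfolding c_def by auto
  have pw: "p m < w" if "m \<in> M" for m using multipartite_part[OF M that] .
  have pw': "p' d < w" if "d \<in> M'" for d using multipartite_part[OF M' that] t_le_w by simp
  have g_less: "g i j < w + e" if "i < w" for i j using that r unfolding g_def by auto
  have h_less: "h j i < w + e" if "j < w" for i j using that r unfolding h_def by auto
  have g_neq: "g i j \<noteq> g i' j'" if "i < w" "i' < w" "i \<noteq> i'" for i j i' j'
    using that r unfolding g_def by (simp split: if_split; linarith)
  have h_neq: "h i j \<noteq> h i' j'" if "i < w" "i' < w" "i \<noteq> i'" for i j i' j'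
  proof -
    consider "i < r" "i' < r" | "i < r" "r \<le> i'" | "r \<le> i" "i' < r" | "r \<le> i" "r \<le> i'" by linarith
    then show ?thesis
      using that r unfolding h_def by cases (simp split: if_split; linarith)+
  qed
  have gh: "g i j \<noteq> h j i" if "i < w" "j < w" for i j
  proof -
    consider "i < r" "j < r" | "i < r" "r \<le> j" | "r \<le> i" "j < r" | "r \<le> i" "r \<le> j" by linarith
    then show ?thesis
      using that r unfolding g_def h_def by cases (simp split: if_split; linarith)+
  qed
  have MM': "c m \<noteq> c d" if "m \<in> M" "d \<in> M'" "E m d" for m d
    using gh[OF pw[OF that(1)] pw'[OF that(2)]] pair.view_M'[OF that] pair.view'_M[OF that]
      cM[OF that(1)] cM'[OF that(2)] by simp
  have MM: "c u \<noteq> c v" if "u \<in> M" "v \<in> M" "E u v" for u v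
    using that g_neq[OF pw pw] multipartite_E[OF M that(1,2)] cM by simp
  have M'M': "c u \<noteq> c v" if "u \<in> M'" "v \<in> M'" "E u v" for u v
    using that h_neq[OF pw' pw'] multipartite_E[OF M' that(1,2)] cM' by simp
  define A where "A = (\<lambda>v. {\<pi> v, \<pi> v + e} \<union> (if \<rho> v < r then {r + \<rho> v}
    else {\<rho> v - r, if \<rho> v - r + e < r then \<rho> v - r + e else \<rho> v + e}))"
  have "colorable ((M \<union> M') \<union> R) (w + e)"
  proof (rule colorable_extend_independent[of _ c _ _ A])
    show "c v < w + e" if "v \<in> M \<union> M'" for v
      using that cM cM' g_less[OF pw] h_less[OF pw'] by auto
    show "c u \<noteq> c v" if uv: "u \<in> M \<union> M'" "v \<in> M \<union> M'" "E u v" for u v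
      using uv MM[of u v] M'M'[of u v] MM'[of u v] MM'[of v u] sym[OF uv(3)] by (metis UnE)
    show "finite (A v) \<and> card (A v) < w + e \<and> (\<forall>u\<in>M \<union> M'. E u v \<longrightarrow> c u \<in> A v)" if v: "v \<in> R" for v
    proof (intro conjI ballI impI)
      show "finite (A v)" unfolding A_def by simp
      have "card (A v) \<le> card {\<pi> v, \<pi> v + e} + card (if \<rho> v < r then {r + \<rho> v}
        else {\<rho> v - r, if \<rho> v - r + e < r then \<rho> v - r + e else \<rho> v + e})"
        unfolding A_def by (rule card_Un_le)
      also have "\<dots> \<le> 2 + 2" by (intro add_mono) (auto simp: card_insert_if)
      finally show "card (A v) < w + e" using w e by linarith
      fix u assume u: "u \<in> M \<union> M'" "E u v"
      show "c u \<in> A v"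
      proof (cases "u \<in> M")
        case True
        then have "p u = \<pi> v" using view_R[OF v True] sym[OF u(2)] by simp
        then show ?thesis using cM[OF True] unfolding A_def g_def by auto
      next
        case False
        then have "u \<in> M'" using u by blast
        moreover from this have "p' u = \<rho> v" using view'_R[OF v] sym[OF u(2)] by simp
        ultimately show ?thesis using cM' unfolding A_def h_def by auto
      qed
    qed
  qed (rule ind)
  moreover have "(M \<union> M') \<union> R = V" using MV M'V by blast
  ultimately show ?thesis by simp
qed

lemma colorable_type_one:
  assumes e: "w \<le> 3 * e" "2 * e \<le> w"
  shows "colorable V (w + e)"
proof (cases "\<exists>x y. x \<in> R \<and> y \<in> R \<and> E x y")
  case True
  then have "colorable V (w + 2)" using colorable_parallel colorable_nonparallel by metis
  then show ?thesis by (rule colorable_mono) (use w e in auto)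
next
  case False
  then show ?thesis by (intro colorable_independent_rest e) blast
qed

end

section \<open>Some vertex of \<open>M\<close> sees several parts of \<open>M'\<close>\<close>

locale type_two_graph = two_split_graph +
  fixes m\<^sub>0 :: 'a and a :: nat
  assumes m0: "m\<^sub>0 \<in> M" and a: "a < t"
    and m0_sees: "d \<in> M' \<Longrightarrow> p' d \<noteq> a \<Longrightarrow> E m\<^sub>0 d"
begin

abbreviation i\<^sub>0 :: nat where "i\<^sub>0 \<equiv> p m\<^sub>0"

lemma view_C: "d \<in> M' \<Longrightarrow> p' d \<noteq> a \<Longrightarrow> \<pi> d = i\<^sub>0"
  using view_M' m0 m0_sees by blast

text \<open>Outside part \<open>a\<close>, every vertex of \<open>M'\<close> sees
  \<open>m\<^sub>0\<close> and hence no part but \<open>i\<^sub>0\<close>. This is the hypothesis on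
  edges in \<open>colorable_keyed\<close>.\<close>

lemma touches: "m \<in> M \<Longrightarrow> d \<in> M' \<Longrightarrow> E m d \<Longrightarrow> p m = i\<^sub>0 \<or> p' d = a"
  using view_C view_M' by metis

text \<open>Two free parts of \<open>M'\<close> other than \<open>a\<close> would contain an edge
  missing the path \<open>y x n n'\<close>: their vertices see only part \<open>i\<^sub>0\<close> of
  \<open>M\<close>, which \<open>n\<close> and \<open>n'\<close> avoid.\<close>

lemma private_neighbour:
  assumes xy: "x \<in> R" "y \<in> R" "E x y" and n: "n \<in> M" "E x n" "\<not> E y n" "p n \<noteq> i\<^sub>0"
  shows "t = 4 \<and> a < t \<and> \<rho> x < t \<and> \<rho> y < t \<and> a \<noteq> \<rho> x \<and> a \<noteq> \<rho> y \<and> \<rho> x \<noteq> \<rho> y"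
proof (rule three_distinct_if_at_most_one_avoids[OF t], rule ccontr)
  fix i j assume ij: "i < t" "j < t" "i \<notin> {a, \<rho> x, \<rho> y}" "j \<notin> {a, \<rho> x, \<rho> y}" "i \<noteq> j"
  obtain k where k: "k < w" "k \<noteq> p n" "k \<noteq> \<pi> y" "k \<noteq> i\<^sub>0"
    using obtain_less_avoiding3[of w "p n" "\<pi> y" i\<^sub>0] w by auto
  obtain n' where n': "n' \<in> M" "p n' = k" using multipartite_rep[OF M k(1)] .
  obtain f where f: "f \<in> M'" "p' f = i" using multipartite_rep[OF M' ij(1)] .
  obtain g where g: "g \<in> M'" "p' g = j" using multipartite_rep[OF M' ij(2)] .
  have "\<pi> x = p n" using view_R xy n by blast
  then have "\<not> E x n'" "\<not> E y n'" "E n n'"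
    using view_R[OF xy(1), of n'] view_R[OF xy(2), of n'] multipartite_E[OF M, of n n'] n n' k by auto
  then have "is_P4 y x n n'" unfolding is_P4_def using xy(3) n sym by blast
  moreover have "E f g" using multipartite_E[OF M'] f g ij by auto
  moreover have "\<not> E f x" "\<not> E f y" "\<not> E g x" "\<not> E g y"
    using view'_R xy f g ij sym by (metis insertCI)+
  moreover have "\<not> E f n" "\<not> E f n'" "\<not> E g n" "\<not> E g n'"
    using touches[of n] touches[of n'] n n' f g ij k sym by (metis insertCI)+
  ultimately show False using P2_P4[of y x n n' f g] by blast
qed

text \<open>The path \<open>y x d f\<close> lies outside \<open>M\<close> and has no views but
  \<open>i\<^sub>0\<close>, \<open>\<pi> x\<close> and \<open>\<pi> y\<close>, so two further parts
  of \<open>M\<close> would contradict \<open>P4_view\<close>.\<close>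

lemma private_neighbour':
  assumes xy: "x \<in> R" "y \<in> R" "E x y" and d: "d \<in> M'" "E x d" "\<not> E y d" "p' d \<noteq> a"
  shows "w = 4 \<and> i\<^sub>0 < w \<and> \<pi> x < w \<and> \<pi> y < w \<and> i\<^sub>0 \<noteq> \<pi> x \<and> i\<^sub>0 \<noteq> \<pi> y \<and> \<pi> x \<noteq> \<pi> y"
proof (rule three_distinct_if_at_most_one_avoids[OF w], rule ccontr)
  fix i j assume ij: "i < w" "j < w" "i \<notin> {i\<^sub>0, \<pi> x, \<pi> y}" "j \<notin> {i\<^sub>0, \<pi> x, \<pi> y}" "i \<noteq> j"
  obtain k where k: "k < t" "k \<noteq> p' d" "k \<noteq> \<rho> y" "k \<noteq> a"
    using obtain_less_avoiding3[of t "p' d" "\<rho> y" a] t by auto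
  obtain f where f: "f \<in> M'" "p' f = k" using multipartite_rep[OF M' k(1)] .
  have "\<rho> x = p' d" using view'_R xy d by blast
  then have "\<not> E x f" "\<not> E y f" "E d f"
    using view'_R[OF xy(1), of f] view'_R[OF xy(2), of f] multipartite_E[OF M', of d f] d f k by auto
  then have "is_P4 y x d f" unfolding is_P4_def using xy(3) d sym by blast
  moreover have "{y, x, d, f} \<subseteq> V - M" using xy d f M'V by blast
  ultimately show False
    using P4_view[of y x d f i j] ij view_C[of d] view_C[of f] d f k by auto
qed

text \<open>The only edges of \<open>R\<close> that can fail to be keyed: both private-neighbour
  lemmas apply in their extreme four-part form.\<close>

definition crossing :: "'a \<Rightarrow> 'a \<Rightarrow> bool" where
  "crossing x y \<longleftrightarrow> w = 4 \<and> t = 4 \<and> \<pi> x < w \<and> \<pi> y < w \<and> i\<^sub>0 \<noteq> \<pi> x \<and> i\<^sub>0 \<noteq> \<pi> y \<and> \<pi> x \<noteq> \<pi> y \<and>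
    \<rho> x < t \<and> \<rho> y < t \<and> a \<noteq> \<rho> x \<and> a \<noteq> \<rho> y \<and> \<rho> x \<noteq> \<rho> y"

lemma crossing_commute: "crossing x y \<longleftrightarrow> crossing y x"
  unfolding crossing_def by auto

lemma crossing_if_view:
  assumes xy: "x \<in> R" "y \<in> R" "E x y" and view: "\<pi> x \<noteq> \<pi> y" "\<pi> x \<notin> {w, i\<^sub>0}"
  shows "crossing x y"
proof -
  have "\<pi> x < w" using view(2) view_le[OF M, of x] by auto
  then obtain n where n: "n \<in> M" "E x n" using view_less by blast
  moreover have "\<not> E y n" "p n \<noteq> i\<^sub>0"
    using view_R[OF xy(1) n] view_R[OF xy(2) n(1)] view by auto
  ultimately have T: "t = 4 \<and> a < t \<and> \<rho> x < t \<and> \<rho> y < t \<and> a \<noteq> \<rho> x \<and> a \<noteq> \<rho> y \<and> \<rho> x \<noteq> \<rho> y"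
    using private_neighbour[OF xy] by blast
  then obtain d where d: "d \<in> M'" "E x d" using view_less[of t M' p' x] by blast
  moreover have "\<not> E y d" "p' d \<noteq> a"
    using view'_R[OF xy(1) d] view'_R[OF xy(2) d(1)] T by auto
  ultimately have "w = 4 \<and> i\<^sub>0 < w \<and> \<pi> x < w \<and> \<pi> y < w \<and> i\<^sub>0 \<noteq> \<pi> x \<and> i\<^sub>0 \<noteq> \<pi> y \<and> \<pi> x \<noteq> \<pi> y"
    using private_neighbour'[OF xy] by blast
  with T show ?thesis unfolding crossing_def by blast
qed

lemma crossing_if_view':
  assumes xy: "x \<in> R" "y \<in> R" "E x y" and view: "\<rho> x \<noteq> \<rho> y" "\<rho> x \<notin> {t, a}"
  shows "crossing x y"
proof -
  have "\<rho> x < t" using view(2) view_le[OF M', of x] by auto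
  then obtain d where d: "d \<in> M'" "E x d" using view_less by blast
  moreover have "\<not> E y d" "p' d \<noteq> a"
    using view'_R[OF xy(1) d] view'_R[OF xy(2) d(1)] view by auto
  ultimately have "\<pi> x < w" "i\<^sub>0 \<noteq> \<pi> x" "\<pi> x \<noteq> \<pi> y" using private_neighbour'[OF xy] by blast+
  then show ?thesis using crossing_if_view[OF xy] by auto
qed

lemma keyed_commute: "keyed i b x y \<longleftrightarrow> keyed i b y x"
  unfolding keyed_def by auto

lemma keyed_or_crossing:
  assumes xy: "x \<in> R" "y \<in> R" "E x y" shows "keyed i\<^sub>0 a x y \<or> crossing x y"
proof (cases "crossing x y")
  case False
  then have nc: "\<not> crossing x y" "\<not> crossing y x" using crossing_commute by blast+
  have "\<pi> x = \<pi> y \<or> \<pi> x \<in> {w, i\<^sub>0} \<and> \<pi> y \<in> {w, i\<^sub>0}"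
    using crossing_if_view[OF xy] crossing_if_view[OF xy(2,1) sym[OF xy(3)]] nc by metis
  moreover have "\<rho> x = \<rho> y \<or> \<rho> x \<in> {t, a} \<and> \<rho> y \<in> {t, a}"
    using crossing_if_view'[OF xy] crossing_if_view'[OF xy(2,1) sym[OF xy(3)]] nc by metis
  ultimately show ?thesis unfolding keyed_def by simp
qed simp

text \<open>If \<open>m\<^sub>0\<close> saw \<open>d\<close>, it would extend a transversal clique
  of \<open>M'\<close> to \<open>w + 1\<close> vertices. So \<open>n m\<^sub>0 c d\<close> is a
  \<open>P4\<close> for suitable \<open>n\<close> and \<open>c\<close> unseen by \<open>uv\<close>,
  which must then see \<open>m\<^sub>0\<close> or \<open>d\<close>.\<close>

lemma keyed_attached:
  assumes uv: "u \<in> R" "v \<in> R" "E u v" and wt: "w = t"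
    and views: "{\<pi> u, \<pi> v} \<subseteq> {w, i\<^sub>0, i}" "{\<rho> u, \<rho> v} \<subseteq> {t, a, j}"
    and d: "d \<in> M'" "p' d = a"
  shows "E u m\<^sub>0 \<or> E v m\<^sub>0 \<or> E u d \<or> E v d"
proof (rule ccontr)
  assume no: "\<not> ?thesis"
  have md: "\<not> E m\<^sub>0 d"
  proof
    assume md: "E m\<^sub>0 d"
    obtain Q where Q: "Q \<subseteq> M'" "is_clique Q" "card Q = t" "d \<in> Q" using transversal_clique[OF M' d(1)] .
    have "E m\<^sub>0 q" if "q \<in> Q" for q
    proof (cases "q = d")
      case False
      then have "E d q" using is_cliqueD[OF Q(2,4) that] by simp
      then have "p' q \<noteq> a" using multipartite_E[OF M' d(1), of q] Q(1) that d(2) by auto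
      then show ?thesis using m0_sees Q(1) that by blast
    qed (use md in simp)
    then have "is_clique (insert m\<^sub>0 Q)" using is_clique_insert[OF Q(2)] by blast
    moreover have "insert m\<^sub>0 Q \<subseteq> V" using Q(1) m0 in_V by blast
    moreover have "m\<^sub>0 \<notin> Q" "finite Q" using disjoint m0 Q(1) finite_subset_V[of Q] M'V by blast+
    ultimately show False using clique_le[of "insert m\<^sub>0 Q"] Q(3) wt by simp
  qed
  obtain k where k: "k < w" "k \<noteq> i\<^sub>0" "k \<noteq> i" "k \<noteq> \<pi> d"
    using obtain_less_avoiding3[of w i\<^sub>0 i "\<pi> d"] w by auto
  obtain n where n: "n \<in> M" "p n = k" using multipartite_rep[OF M k(1)] .
  obtain l where l: "l < t" "l \<noteq> a" "l \<noteq> j" using obtain_less_avoiding3[of t a j j] t by auto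
  obtain c where c: "c \<in> M'" "p' c = l" using multipartite_rep[OF M' l(1)] .
  have P4: "is_P4 n m\<^sub>0 c d"
    unfolding is_P4_def
  proof (intro conjI)
    show "E n m\<^sub>0" using multipartite_E[OF M n(1) m0] n k by simp
    show "E m\<^sub>0 c" using m0_sees[OF c(1)] c l by simp
    show "E c d" using multipartite_E[OF M' c(1) d(1)] c d l by simp
    show "\<not> E n c" using touches[OF n(1) c(1)] n c k l by auto
    show "\<not> E n d" using view_M'[OF d(1) n(1)] n k by auto
  qed (rule md)
  have "k \<notin> {\<pi> u, \<pi> v}" using views(1) k by auto
  then have "\<not> E u n" "\<not> E v n" using view_R[OF uv(1) n(1)] view_R[OF uv(2) n(1)] n(2) by auto
  moreover have "l \<notin> {\<rho> u, \<rho> v}" using views(2) l by auto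
  then have "\<not> E u c" "\<not> E v c" using view'_R[OF uv(1) c(1)] view'_R[OF uv(2) c(1)] c(2) by auto
  ultimately show False using P2_P4[OF P4 uv(3)] no by blast
qed

text \<open>Both ends then share views other than \<open>i\<^sub>0\<close> and \<open>a\<close>, so
  neither can see \<open>m\<^sub>0\<close> or \<open>d\<close>.\<close>

lemma keyed_at_foreign_vertex:
  assumes uv: "u \<in> R" "v \<in> R" "E u v" and wt: "w = t" and key: "keyed i\<^sub>0 a u v"
    and foreign: "\<pi> u \<notin> {w, i\<^sub>0}" "\<rho> u \<notin> {t, a}"
  shows False
proof -
  have eq: "\<pi> v = \<pi> u" "\<rho> v = \<rho> u" using key foreign unfolding keyed_def by auto
  obtain d where d: "d \<in> M'" "p' d = a" using multipartite_rep[OF M' a] .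
  from keyed_attached[OF uv wt _ _ d, of "\<pi> u" "\<rho> u"] eq show False
    using view_R[OF uv(1) m0] view_R[OF uv(2) m0] view'_R[OF uv(1) d(1)] view'_R[OF uv(2) d(1)]
      d foreign by auto
qed

lemma keyed_or_crossing_exclusive:
  assumes xy: "x \<in> R" "y \<in> R" "E x y" "crossing x y" and uv: "u \<in> R" "v \<in> R" "E u v" "keyed i\<^sub>0 a u v"
  shows False
proof -
  have wt: "w = t" using xy(4) unfolding crossing_def by simp
  have foreign: "\<pi> s \<notin> {w, i\<^sub>0}" "\<rho> s \<notin> {t, a}" if "crossing s r" for s r
    using that unfolding crossing_def by auto
  \<comment> \<open>The ends of \<open>xy\<close> are foreign, so a joining edge cannot be keyed; a
    crossing one would make an end of the keyed edge \<open>uv\<close> foreign.\<close>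
  have apart: "\<not> E z s" if z: "z \<in> {u, v}" and s: "s \<in> {x, y}" for z s
  proof
    assume E: "E z s"
    have R: "z \<in> R" "s \<in> R" using z s uv xy by auto
    have sf: "\<pi> s \<notin> {w, i\<^sub>0}" "\<rho> s \<notin> {t, a}"
      using s foreign[of x y] foreign[of y x] xy(4) crossing_commute by auto
    from keyed_or_crossing[OF R E] show False
    proof
      assume "keyed i\<^sub>0 a z s"
      then show False using keyed_at_foreign_vertex[OF R(2,1) sym[OF E] wt _ sf] keyed_commute by blast
    next
      assume "crossing z s"
      then show False
        using z keyed_at_foreign_vertex[OF uv(1-3) wt uv(4)] keyed_commute[of i\<^sub>0 a u v] uv(4)
          keyed_at_foreign_vertex[OF uv(2,1) sym[OF uv(3)] wt] foreign[of z s] by auto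
    qed
  qed
  obtain l where l: "l < w" "l \<noteq> \<pi> x" "l \<noteq> \<pi> y" "l \<noteq> i\<^sub>0"
    using obtain_less_avoiding3[of w "\<pi> x" "\<pi> y" i\<^sub>0] w by auto
  have meet: "{\<pi> u, \<pi> v} \<inter> {\<pi> s, k} \<noteq> {}"
    if sr: "{s, r} = {x, y}" "s \<noteq> r" and k: "k < w" "k \<notin> {\<pi> x, \<pi> y}" for s r k
  proof -
    have sr': "s \<in> R" "r \<in> R" "E r s" "\<pi> s < w" "\<pi> s \<noteq> \<pi> r" "s \<in> {x, y}" "r \<in> {x, y}"
      using sr xy sym unfolding crossing_def by (auto simp: doubleton_eq_iff)
    obtain n where n: "n \<in> M" "E s n" using view_less[OF sr'(4)] .
    have pn: "p n = \<pi> s" using view_R[OF sr'(1) n] by simp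
    obtain m where m: "m \<in> M" "p m = k" using multipartite_rep[OF M k(1)] .
    have "k \<noteq> \<pi> s" "k \<noteq> \<pi> r" using k(2) sr'(6,7) by auto
    then have "\<not> E r n" "\<not> E r m" "\<not> E s m" "E n m"
      using sr'(5) pn m(2) view_R[OF sr'(2) n(1)] view_R[OF sr'(2) m(1)]
        view_R[OF sr'(1) m(1)] multipartite_E[OF M n(1) m(1)] by auto
    then have P4: "is_P4 r s n m"
      unfolding is_P4_def using sr'(3) n(2) by blast
    from P2_P4[OF P4 uv(3)] have "E u n \<or> E u m \<or> E v n \<or> E v m"
      using apart[of u] apart[of v] sr'(6,7) by blast
    then show ?thesis using view_R[OF uv(1)] view_R[OF uv(2)] n(1) m pn by auto
  qed
  have ne: "x \<noteq> y" using xy(3) irrefl by auto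
  have i0: "i\<^sub>0 < w" using multipartite_part[OF M m0] .
  have fresh: "l \<notin> {\<pi> x, \<pi> y}" "i\<^sub>0 \<notin> {\<pi> x, \<pi> y}" using l xy(4) unfolding crossing_def by auto
  have yx: "{y, x} = {x, y}" by auto
  \<comment> \<open>The views of \<open>u\<close> and \<open>v\<close> must meet all four sets
    {\<pi> x or \<pi> y, \<open>l\<close> or \<open>i\<^sub>0\<close>}. A common view cannot meet
    three of them, and views in \<open>{w, i\<^sub>0}\<close> miss the set of \<pi> x and
    \<open>l\<close>.\<close>
  note meets = meet[OF refl ne l(1) fresh(1)] meet[OF yx ne[symmetric] l(1) fresh(1)]
    meet[OF refl ne i0 fresh(2)] meet[OF yx ne[symmetric] i0 fresh(2)]
  have C: "\<pi> x < w" "\<pi> y < w" "i\<^sub>0 \<noteq> \<pi> x" "i\<^sub>0 \<noteq> \<pi> y" "\<pi> x \<noteq> \<pi> y"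
    using xy(4) unfolding crossing_def by auto
  from uv(4) consider "\<pi> u = \<pi> v" | "\<pi> u \<in> {w, i\<^sub>0}" "\<pi> v \<in> {w, i\<^sub>0}"
    unfolding keyed_def by auto
  then show False
  proof cases
    case 1
    then have "\<pi> u \<in> {\<pi> x, l}" "\<pi> u \<in> {\<pi> y, l}" "\<pi> u \<in> {\<pi> x, i\<^sub>0}" using meets(1-3) by auto
    then show False using C l by auto
  next
    case 2
    then show False using meets(1) C l by auto
  qed
qed

text \<open>Adjacent vertices of \<open>R\<close> see different parts of \<open>M\<close>, so a
  colour depending only on \<pi> works. The three parts other than \<open>i\<^sub>0\<close>
  correspond to the colours \<open>i\<^sub>0\<close>, \<open>w\<close>, \<open>w + 1\<close>:
  non-isolated vertices see neither part \<open>i\<^sub>0\<close> of \<open>M\<close> nor part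
  \<open>a\<close> of \<open>M'\<close>, and \<open>w\<close> occurs only on the latter.\<close>

lemma colorable_crossing:
  assumes ex: "x \<in> R" "y \<in> R" "E x y" "crossing x y"
    and all: "\<And>u v. u \<in> R \<Longrightarrow> v \<in> R \<Longrightarrow> E u v \<Longrightarrow> crossing u v"
  shows "colorable V (w + 2)"
proof -
  have wt: "w = 4" "t = 4" using ex(4) unfolding crossing_def by auto
  have i0: "i\<^sub>0 < w" using multipartite_part[OF M m0] .
  let ?L = "{i\<^sub>0, w, w + 1}"
  have "card ({..<w} - {i\<^sub>0}) \<le> card ?L" using wt i0 by auto
  then obtain g where g: "g ` ({..<w} - {i\<^sub>0}) \<subseteq> ?L" "inj_on g ({..<w} - {i\<^sub>0})"
    using card_le_inj[of "{..<w} - {i\<^sub>0}" ?L] by auto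
  define N where "N = {v \<in> R. \<exists>u\<in>R. E u v}"
  have Nv: "\<pi> v \<in> {..<w} - {i\<^sub>0}" "\<rho> v < t" "\<rho> v \<noteq> a" if v: "v \<in> N" for v
  proof -
    obtain u where "u \<in> R" "v \<in> R" "E u v" using v unfolding N_def by blast
    from all[OF this] have "\<pi> v < w \<and> i\<^sub>0 \<noteq> \<pi> v \<and> \<rho> v < t \<and> a \<noteq> \<rho> v"
      unfolding crossing_def by blast
    then show "\<pi> v \<in> {..<w} - {i\<^sub>0}" "\<rho> v < t" "\<rho> v \<noteq> a" by auto
  qed
  let ?f = "recolor i\<^sub>0 a"
  define c where "c = (\<lambda>v. if v \<in> M then p v else if v \<in> M' then ?f (p' v) else g (\<pi> v))"
  have cM: "c m = p m" if "m \<in> M" for m using that unfolding c_def by simp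
  have cM': "c d = ?f (p' d)" if "d \<in> M'" for d using that disjoint unfolding c_def by auto
  have cN: "c v \<in> ?L" "c v = g (\<pi> v)" if "v \<in> N" for v
  proof -
    show "c v = g (\<pi> v)" using that unfolding c_def N_def by auto
    then show "c v \<in> ?L" using g(1) Nv(1)[OF that] by auto
  qed
  have MM: "c u \<noteq> c v" if "u \<in> M" "v \<in> M" "E u v" for u v
    using that multipartite_E[OF M] cM by auto
  have M'M': "c u \<noteq> c v" if "u \<in> M'" "v \<in> M'" "E u v" for u v
    using that multipartite_E[OF M'] multipartite_part[OF M'] recolor_inj[OF a] cM' by metis
  have MM': "c m \<noteq> c d" if "m \<in> M" "d \<in> M'" "E m d" for m d
    using recolor_proper[OF a that(1,2) touches[OF that]] cM[OF that(1)] cM'[OF that(2)] by simp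
  have MN: "c m \<noteq> c v" if "m \<in> M" "v \<in> N" "E v m" for m v
  proof -
    have "p m = \<pi> v" using view_R[of v m] that unfolding N_def by auto
    then show ?thesis using Nv(1)[OF that(2)] cN(1)[OF that(2)] cM[OF that(1)] by auto
  qed
  have M'N: "c d \<noteq> c v" if "d \<in> M'" "v \<in> N" "E v d" for d v
  proof -
    have "p' d = \<rho> v" using view'_R[of v d] that unfolding N_def by auto
    then have "?f (p' d) < w" "?f (p' d) \<noteq> i\<^sub>0"
      using Nv(2,3)[OF that(2)] wt a unfolding recolor_def by auto
    then show ?thesis using cN(1)[OF that(2)] cM'[OF that(1)] by auto
  qed
  have NN: "c u \<noteq> c v" if "u \<in> N" "v \<in> N" "E u v" for u v
  proof -
    have "\<pi> u \<noteq> \<pi> v" using all[of u v] that unfolding N_def crossing_def by auto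
    then have "g (\<pi> u) \<noteq> g (\<pi> v)" using inj_onD[OF g(2)] Nv(1) that(1,2) by metis
    then show ?thesis using cN that by simp
  qed
  have "colorable ((M \<union> M' \<union> N) \<union> (R - N)) (w + 2)"
  proof (rule colorable_extend_independent[of _ c _ _ "\<lambda>v. {\<pi> v, ?f (\<rho> v)}"])
    show "c v < w + 2" if "v \<in> M \<union> M' \<union> N" for v
    proof -
      consider "v \<in> M" | "v \<in> M'" | "v \<in> N" using \<open>v \<in> M \<union> M' \<union> N\<close> by blast
      then show ?thesis
      proof cases
        case 1 then show ?thesis using cM[OF 1] multipartite_part[OF M 1] by simp
      next
        case 2 then show ?thesis using cM'[OF 2] recolor_less[OF a multipartite_part[OF M' 2], of i\<^sub>0] by simp
      next
        case 3 then show ?thesis using cN(1)[OF 3] i0 by auto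
      qed
    qed
    show "c u \<noteq> c v" if uv: "u \<in> M \<union> M' \<union> N" "v \<in> M \<union> M' \<union> N" "E u v" for u v
    proof -
      have "u \<in> M \<or> u \<in> M' \<or> u \<in> N" "v \<in> M \<or> v \<in> M' \<or> v \<in> N" using uv by blast+
      then show ?thesis using MM MM' M'M' MN M'N NN uv(3) sym[OF uv(3)] by metis
    qed
    show "\<not> E u v" if "u \<in> R - N" "v \<in> R - N" for u v using that unfolding N_def by blast
    show "finite {\<pi> v, ?f (\<rho> v)} \<and> card {\<pi> v, ?f (\<rho> v)} < w + 2 \<and>
      (\<forall>u\<in>M \<union> M' \<union> N. E u v \<longrightarrow> c u \<in> {\<pi> v, ?f (\<rho> v)})" if v: "v \<in> R - N" for v
    proof (intro conjI ballI impI)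
      show "card {\<pi> v, ?f (\<rho> v)} < w + 2" using wt by (simp add: card_insert_if)
      fix u assume u: "u \<in> M \<union> M' \<union> N" "E u v"
      have vR: "v \<in> R" using v by blast
      have "u \<notin> N" using u v unfolding N_def by blast
      then consider "u \<in> M" | "u \<in> M'" using u by blast
      then show "c u \<in> {\<pi> v, ?f (\<rho> v)}"
      proof cases
        case 1 then show ?thesis using cM[OF 1] view_R[OF vR 1 sym[OF u(2)]] by simp
      next
        case 2 then show ?thesis using cM'[OF 2] view'_R[OF vR 2 sym[OF u(2)]] by simp
      qed
    qed simp
  qed
  moreover have "(M \<union> M' \<union> N) \<union> (R - N) = V" using MV M'V unfolding N_def by blast
  ultimately show ?thesis by simp
qed

lemma colorable_type_two: "colorable V (w + 2)"
proof (cases "\<exists>x y. x \<in> R \<and> y \<in> R \<and> E x y \<and> crossing x y")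
  case True
  then obtain x y where xy: "x \<in> R" "y \<in> R" "E x y" "crossing x y" by blast
  show ?thesis
    by (rule colorable_crossing[OF xy]) (use keyed_or_crossing keyed_or_crossing_exclusive[OF xy] in blast)
next
  case False
  show ?thesis
    by (rule colorable_keyed[OF a touches]) (use keyed_or_crossing False in blast)+
qed

end

section \<open>The colouring bound for clique numbers from four on\<close>

context free_graph begin

lemma colorable_four_thirds:
  assumes Q: "Q \<subseteq> V" "is_clique Q" "card Q = w" and w: "4 \<le> w"
    and max: "\<And>S. S \<subseteq> V \<Longrightarrow> is_clique S \<Longrightarrow> card S \<le> w"
    and e: "w \<le> 3 * e" "2 * e \<le> w"
  shows "colorable V (w + e)"
proof -
  obtain M p where M: "M \<subseteq> V" "multipartite w M p" "\<And>b. b \<in> V - M \<Longrightarrow> sees_one_part M p b"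
    using maximum_clique_multipartite[OF subset_refl Q w max] by blast
  interpret split_graph V E w M p
    by unfold_locales (use w M max in auto)
  have e2: "w + 2 \<le> w + e" using w e by linarith
  obtain S where S: "S \<subseteq> V - M" "is_clique S" "\<And>T. T \<subseteq> V - M \<Longrightarrow> is_clique T \<Longrightarrow> card T \<le> card S"
    using max_clique[of "V - M"] finite_V by (metis finite_Diff)
  show ?thesis
  proof (cases "card S \<le> 3")
    case True
    let ?F = "{v \<in> V - M. \<pi> v \<in> {0, 1}}"
    have "colorable V (w + 2)"
    proof (rule colorable_pairing[of ?F "V - M - ?F" 0 1])
      show "card T \<le> 3" if "T \<subseteq> ?F" "is_clique T" for T
        using S(3)[of T] that True by fastforce
      show "card T \<le> 3" if "T \<subseteq> V - M - ?F" "is_clique T" for T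
        using S(3)[of T] that True by fastforce
    qed (use w in auto)
    then show ?thesis using e2 by (rule colorable_mono)
  next
    case False
    then have t: "4 \<le> card S" by simp
    obtain M' p' where N: "M' \<subseteq> V - M" "multipartite (card S) M' p'"
      "\<And>b. b \<in> V - M - M' \<Longrightarrow> sees_one_part M' p' b"
      using maximum_clique_multipartite[OF Diff_subset S(1,2) refl t S(3)] by blast
    interpret two_split_graph V E w M p "card S" M' p'
      by unfold_locales (use t N in auto)
    show ?thesis
    proof (cases "\<forall>m\<in>M. sees_one_part M' p' m")
      case True
      then interpret type_one_graph V E w M p "card S" M' p'
        by unfold_locales auto
      show ?thesis by (rule colorable_type_one[OF e])
    next
      case False
      then obtain m d f where m: "m \<in> M" "d \<in> M'" "f \<in> M'" "E m d" "E m f" "p' d \<noteq> p' f"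
        unfolding sees_one_part_def by blast
      obtain a where "a < card S" "\<And>x. x \<in> M' \<Longrightarrow> p' x \<noteq> a \<Longrightarrow> E m x"
        using sees_all_but_one_part[OF N(2) t disjoint[OF m(1)] m(2,3,6,4,5)] by blast
      then interpret type_two_graph V E w M p "card S" M' p' m a
        by unfold_locales (use m in auto)
      show ?thesis using colorable_type_two e2 by (rule colorable_mono)
    qed
  qed
qed

end

section \<open>Set-based graphs\<close>

definition adj :: "'a sgraph \<Rightarrow> 'a \<Rightarrow> 'a \<Rightarrow> bool" where
  "adj G u v \<longleftrightarrow> {u, v} \<in> edges G"

lemma graph_adj:
  assumes "fin_sgraph G" shows "graph (verts G) (adj G)"
proof
  show "finite (verts G)" using assms unfolding fin_sgraph_def by blast
  show "x \<in> verts G" if "adj G x y" for x y using assms that unfolding fin_sgraph_def adj_def by blast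
  show "adj G y x" if "adj G x y" for x y using that unfolding adj_def by (simp add: insert_commute)
  show "\<not> adj G x x" for x using assms unfolding fin_sgraph_def adj_def by force
qed

text \<open>Turning the isomorphism around gives a map out of the fixed graph \<open>H\<close>,
  which can be examined vertex by vertex.\<close>

lemma free_of_embedding:
  "free_of H G \<longleftrightarrow> \<not> (\<exists>g. inj_on g (verts H) \<and> g ` verts H \<subseteq> verts G \<and>
    (\<forall>a\<in>verts H. \<forall>b\<in>verts H. {a, b} \<in> edges H \<longleftrightarrow> adj G (g a) (g b)))"
  (is "_ \<longleftrightarrow> \<not> ?emb")
proof -
  have "(\<exists>S\<subseteq>verts G. graph_iso (induced G S) H) \<longleftrightarrow> ?emb"
  proof
    assume "\<exists>S\<subseteq>verts G. graph_iso (induced G S) H"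
    then obtain S f where S: "S \<subseteq> verts G" and f: "bij_betw f S (verts H)"
      and fE: "\<And>u v. u \<in> S \<Longrightarrow> v \<in> S \<Longrightarrow> {u, v} \<in> edges G \<longleftrightarrow> {f u, f v} \<in> edges H"
      unfolding graph_iso_def induced_def by auto
    let ?g = "inv_into S f"
    have g: "bij_betw ?g (verts H) S" using bij_betw_inv_into[OF f] .
    have fg: "f (?g a) = a" if "a \<in> verts H" for a using bij_betw_inv_into_right[OF f that] .
    have gS: "?g a \<in> S" if "a \<in> verts H" for a using bij_betwE[OF g] that by blast
    have "{a, b} \<in> edges H \<longleftrightarrow> adj G (?g a) (?g b)" if "a \<in> verts H" "b \<in> verts H" for a b
      using fE[OF gS gS, OF that] fg[OF that(1)] fg[OF that(2)] unfolding adj_def by simp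
    moreover have "inj_on ?g (verts H)" "?g ` verts H \<subseteq> verts G"
      using g S unfolding bij_betw_def by simp_all
    ultimately show ?emb by (intro exI[of _ ?g]) simp
  next
    assume ?emb
    then obtain g where g: "inj_on g (verts H)" "g ` verts H \<subseteq> verts G"
      and gE: "\<forall>a\<in>verts H. \<forall>b\<in>verts H. {a, b} \<in> edges H \<longleftrightarrow> adj G (g a) (g b)"
      by (elim exE conjE)
    let ?S = "g ` verts H" and ?f = "inv_into (verts H) g"
    have "bij_betw ?f ?S (verts H)" using g(1) by (simp add: bij_betw_inv_into inj_on_imp_bij_betw)
    moreover have "{u, v} \<in> edges (induced G ?S) \<longleftrightarrow> {?f u, ?f v} \<in> edges H" if uv: "u \<in> ?S" "v \<in> ?S" for u v
    proof -
      obtain a b where ab: "a \<in> verts H" "b \<in> verts H" "u = g a" "v = g b" using uv by blast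
      then have "{u, v} \<in> edges (induced G ?S) \<longleftrightarrow> adj G (g a) (g b)"
        unfolding induced_def adj_def by simp
      also have "\<dots> \<longleftrightarrow> {a, b} \<in> edges H" using gE ab(1,2) by simp
      finally show ?thesis using ab g(1) by simp
    qed
    ultimately have "graph_iso (induced G ?S) H"
      unfolding graph_iso_def by (intro exI[of _ ?f]) (simp add: induced_def)
    then show "\<exists>S\<subseteq>verts G. graph_iso (induced G S) H" using g(2) by (intro exI[of _ ?S]) simp
  qed
  then show ?thesis unfolding free_of_def by blast
qed

lemma lessThan_4: "{..<4::nat} = {0, 1, 2, 3}"
  by auto

lemma verts_P2_P4: "verts P2_P4 = {Inl 0, Inl 1, Inr 0, Inr 1, Inr 2, Inr 3}"
  unfolding P2_P4_def disjoint_union_def path_graph_def by (auto simp: lessThan_4)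

lemma edges_P2_P4: "edges P2_P4 = {{Inl 0, Inl 1}, {Inr 0, Inr 1}, {Inr 1, Inr 2}, {Inr 2, Inr 3}}"
proof -
  have "edges (path_graph 2) = {{0, 1}}" unfolding path_graph_def by auto
  moreover have "edges (path_graph 4) = {{0, 1}, {1, 2}, {2, 3}}"
  proof -
    have "{{i, Suc i} |i. Suc i < 4} = (\<lambda>i. {i, Suc i}) ` {..<3}" by auto
    also have "{..<3::nat} = {0, 1, 2}" by auto
    finally show ?thesis unfolding path_graph_def by (simp add: eval_nat_numeral)
  qed
  ultimately show ?thesis unfolding P2_P4_def disjoint_union_def by auto
qed

lemma free_of_P2_P4:
  assumes G: "fin_sgraph G"
  shows "free_of P2_P4 G \<longleftrightarrow> P2_P4_free_graph (verts G) (adj G)"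
proof -
  interpret graph "verts G" "adj G" by (rule graph_adj[OF G])
  show ?thesis
  proof
    assume free: "free_of P2_P4 G"
    show "P2_P4_free_graph (verts G) (adj G)"
    proof (unfold_locales, rule ccontr)
      fix a b c d x y assume P4: "is_P4 a b c d" and xy: "adj G x y"
        and no: "\<not> (adj G x a \<or> adj G x b \<or> adj G x c \<or> adj G x d \<or> adj G y a \<or> adj G y b \<or> adj G y c \<or> adj G y d)"
      define g where "g = (\<lambda>z. case z of Inl i \<Rightarrow> if i = (0::nat) then x else y
        | Inr i \<Rightarrow> if i = (0::nat) then a else if i = 1 then b else if i = 2 then c else d)"
      have g: "g (Inl 0) = x" "g (Inl 1) = y" "g (Inr 0) = a" "g (Inr 1) = b" "g (Inr 2) = c" "g (Inr 3) = d"
        "g (Inl (Suc 0)) = y" "g (Inr (Suc 0)) = b"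
        unfolding g_def by auto
      have adj: "adj G a b" "adj G b c" "adj G c d" "\<not> adj G a c" "\<not> adj G a d" "\<not> adj G b d"
        "adj G b a" "adj G c b" "adj G d c" "\<not> adj G c a" "\<not> adj G d a" "\<not> adj G d b" "adj G y x"
        "\<not> adj G a x" "\<not> adj G b x" "\<not> adj G c x" "\<not> adj G d x"
        "\<not> adj G a y" "\<not> adj G b y" "\<not> adj G c y" "\<not> adj G d y"
        using P4 xy no sym unfolding is_P4_def by blast+
      have ne: "x \<noteq> y" "x \<noteq> a" "x \<noteq> b" "x \<noteq> c" "x \<noteq> d" "y \<noteq> a" "y \<noteq> b" "y \<noteq> c" "y \<noteq> d"
        "a \<noteq> b" "a \<noteq> c" "a \<noteq> d" "b \<noteq> c" "b \<noteq> d" "c \<noteq> d"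
        using adj no xy irrefl by metis+
      have "inj_on g (verts P2_P4)" unfolding verts_P2_P4 using ne by (simp add: g)
      moreover have "g ` verts P2_P4 \<subseteq> verts G"
        unfolding verts_P2_P4 using adj xy E_in_V by (simp add: g)
      moreover have "\<forall>u\<in>verts P2_P4. \<forall>v\<in>verts P2_P4. {u, v} \<in> edges P2_P4 \<longleftrightarrow> adj G (g u) (g v)"
        unfolding verts_P2_P4 edges_P2_P4 using adj xy no irrefl by (simp add: g doubleton_eq_iff)
      ultimately show False using free unfolding free_of_embedding by blast
    qed
  next
    assume "P2_P4_free_graph (verts G) (adj G)"
    then interpret P2_P4_free_graph "verts G" "adj G" .
    show "free_of P2_P4 G"
      unfolding free_of_embedding
    proof (rule notI, elim exE conjE)
      fix g :: "nat + nat \<Rightarrow> 'a"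
      assume g: "\<forall>u\<in>verts P2_P4. \<forall>v\<in>verts P2_P4. {u, v} \<in> edges P2_P4 \<longleftrightarrow> adj G (g u) (g v)"
      have "is_P4 (g (Inr 0)) (g (Inr 1)) (g (Inr 2)) (g (Inr 3))" "adj G (g (Inl 0)) (g (Inl 1))"
        using g unfolding verts_P2_P4 edges_P2_P4 is_P4_def by (simp_all add: doubleton_eq_iff)
      from P2_P4[OF this] show False
        using g unfolding verts_P2_P4 edges_P2_P4 by (simp add: doubleton_eq_iff)
    qed
  qed
qed

lemma verts_HVN: "verts HVN = {0, 1, 2, 3, 4}"
  unfolding HVN_def complete_graph_def by auto

lemma edges_HVN: "{u, v} \<in> edges HVN \<longleftrightarrow>
    u < 5 \<and> v < 5 \<and> u \<noteq> v \<and> {u, v} \<noteq> {0, 1} \<and> {u, v} \<noteq> {0, 2}"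
  unfolding HVN_def complete_graph_def by (auto simp: doubleton_eq_iff)

lemma free_of_HVN:
  assumes G: "fin_sgraph G"
  shows "free_of HVN G \<longleftrightarrow> (\<forall>a b c d v. adj G a b \<longrightarrow> adj G a c \<longrightarrow> adj G a d \<longrightarrow> adj G b c \<longrightarrow>
    adj G b d \<longrightarrow> adj G c d \<longrightarrow> adj G v a \<longrightarrow> adj G v b \<longrightarrow> v \<noteq> c \<longrightarrow> v \<noteq> d \<longrightarrow> adj G v c \<or> adj G v d)"
    (is "_ \<longleftrightarrow> ?free")
proof -
  interpret graph "verts G" "adj G" by (rule graph_adj[OF G])
  show ?thesis
  proof
    assume free: "free_of HVN G"
    show ?free
    proof (intro allI impI, rule ccontr)
      fix a b c d v
      assume adj: "adj G a b" "adj G a c" "adj G a d" "adj G b c" "adj G b d" "adj G c d" "adj G v a" "adj G v b"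
        and ne: "v \<noteq> c" "v \<noteq> d" and no: "\<not> (adj G v c \<or> adj G v d)"
      \<comment> \<open>Vertex 0 of \<open>HVN\<close> has degree two: 3 and 4 are its neighbours, 1
        and 2 the vertices it misses.\<close>
      define g where "g = (\<lambda>i. if i = (0::nat) then v else if i = 1 then c else if i = 2 then d
        else if i = 3 then a else b)"
      have g: "g 0 = v" "g 1 = c" "g 2 = d" "g 3 = a" "g 4 = b" "g (Suc 0) = c" unfolding g_def by auto
      have adj': "adj G b a" "adj G c a" "adj G d a" "adj G c b" "adj G d b" "adj G d c" "adj G a v" "adj G b v"
        "\<not> adj G c v" "\<not> adj G d v"
        using adj no sym by blast+
      have ne': "v \<noteq> a" "v \<noteq> b" "a \<noteq> b" "a \<noteq> c" "a \<noteq> d" "b \<noteq> c" "b \<noteq> d" "c \<noteq> d"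
        using adj irrefl by metis+
      have "inj_on g (verts HVN)" unfolding verts_HVN using ne ne' by (simp add: g)
      moreover have "g ` verts HVN \<subseteq> verts G"
        unfolding verts_HVN using adj adj' E_in_V by (simp add: g)
      moreover have "\<forall>u\<in>verts HVN. \<forall>v\<in>verts HVN. {u, v} \<in> edges HVN \<longleftrightarrow> adj G (g u) (g v)"
        unfolding verts_HVN edges_HVN using adj adj' no irrefl by (simp add: g doubleton_eq_iff)
      ultimately show False using free unfolding free_of_embedding by blast
    qed
  next
    assume free: ?free
    show "free_of HVN G"
      unfolding free_of_embedding
    proof (rule notI, elim exE conjE)
      fix g :: "nat \<Rightarrow> 'a"
      assume inj: "inj_on g (verts HVN)"
        and g: "\<forall>u\<in>verts HVN. \<forall>v\<in>verts HVN. {u, v} \<in> edges HVN \<longleftrightarrow> adj G (g u) (g v)"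
      have ne: "g 0 \<noteq> g 1" "g 0 \<noteq> g 2" using inj unfolding verts_HVN by auto
      have "adj G (g 3) (g 4)" "adj G (g 3) (g 1)" "adj G (g 3) (g 2)" "adj G (g 4) (g 1)" "adj G (g 4) (g 2)"
        "adj G (g 1) (g 2)" "adj G (g 0) (g 3)" "adj G (g 0) (g 4)" "\<not> adj G (g 0) (g 1)" "\<not> adj G (g 0) (g 2)"
        using g unfolding verts_HVN edges_HVN by (simp_all add: doubleton_eq_iff)
      then show False using free ne by blast
    qed
  qed
qed

lemma free_graph_adj:
  assumes "fin_sgraph G"
  shows "free_of P2_P4 G \<and> free_of HVN G \<longleftrightarrow> free_graph (verts G) (adj G)"
  unfolding free_of_P2_P4[OF assms] free_of_HVN[OF assms] free_graph_def free_graph_axioms_def by blast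

section \<open>Clique number, chromatic number and the upper bounds\<close>

lemma clique_number_eq:
  assumes "fin_sgraph G"
  shows "clique_number G = w \<longleftrightarrow> (\<exists>K\<subseteq>verts G. graph.is_clique (adj G) K \<and> card K = w) \<and>
    (\<forall>K\<subseteq>verts G. graph.is_clique (adj G) K \<longrightarrow> card K \<le> w)"
proof -
  interpret graph "verts G" "adj G" by (rule graph_adj[OF assms])
  have "clique K (edges G) \<longleftrightarrow> is_clique K" for K
    unfolding clique_def is_clique_def adj_def by blast
  then have eq: "clique_number G = Max (card ` {K. K \<subseteq> verts G \<and> is_clique K})" (is "_ = Max ?A")
    unfolding clique_number_def by (simp add: setcompr_eq_image)
  have "finite ?A" using finite_V by simp
  moreover have "is_clique {}" unfolding is_clique_def by simp
  then have "?A \<noteq> {}" by blast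
  ultimately show ?thesis unfolding eq by (subst Max_eq_iff) auto
qed

lemma chromatic_number_le_iff:
  assumes "fin_sgraph G"
  shows "chromatic_number G \<le> k \<longleftrightarrow> graph.colorable (adj G) (verts G) k"
proof -
  interpret graph "verts G" "adj G" by (rule graph_adj[OF assms])
  have eq: "chromatic_number G = (LEAST k. colorable (verts G) k)"
    unfolding chromatic_number_def proper_coloring_def colorable_def adj_def ..
  obtain c :: "'a \<Rightarrow> nat" and n where c: "c ` verts G = {i. i < n}" "inj_on c (verts G)"
    using finite_imp_inj_to_nat_seg[OF finite_V] by blast
  then have "colorable (verts G) n"
    unfolding colorable_def using irrefl by (intro exI[of _ c]) (auto dest: inj_onD)
  then have "\<exists>k. colorable (verts G) k" by blast
  then show ?thesis
    unfolding eq using LeastI_ex[of "colorable (verts G)"] Least_le[of "colorable (verts G)" k] colorable_mono by blast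
qed

lemma chromatic_number_bounds:
  fixes G :: "'a sgraph"
  assumes G: "fin_sgraph G" "free_of P2_P4 G" "free_of HVN G"
  shows "clique_number G = 2 \<Longrightarrow> chromatic_number G \<le> 4"
    and "clique_number G = 3 \<Longrightarrow> chromatic_number G \<le> 10"
    and "4 \<le> clique_number G \<Longrightarrow> int (chromatic_number G) \<le> \<lceil>4 / 3 * real (clique_number G)\<rceil>"
proof -
  interpret free_graph "verts G" "adj G" using free_graph_adj G by blast
  let ?w = "clique_number G"
  obtain K where K: "K \<subseteq> verts G" "is_clique K" "card K = ?w"
    and max: "\<And>Q. Q \<subseteq> verts G \<Longrightarrow> is_clique Q \<Longrightarrow> card Q \<le> ?w"
    using clique_number_eq[OF G(1), of ?w] by blast
  show "chromatic_number G \<le> 4" if "?w = 2"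
    unfolding chromatic_number_le_iff[OF G(1)] using colorable_if_triangle_free max that by simp
  show "chromatic_number G \<le> 10" if three: "?w = 3"
  proof -
    obtain a b c where abc: "K = {a, b, c}" "a \<noteq> b" "a \<noteq> c" "b \<noteq> c"
      using K(3)[unfolded three] unfolding card_3_iff by blast
    have "adj G a b" "adj G a c" "adj G b c" by (rule is_cliqueD[OF K(2)]; simp add: abc)+
    then show ?thesis
      unfolding chromatic_number_le_iff[OF G(1)] using colorable_if_K4_free max three by simp
  qed
  show "int (chromatic_number G) \<le> \<lceil>4 / 3 * real ?w\<rceil>" if w: "4 \<le> ?w"
  proof -
    \<comment> \<open>A third of the clique number, rounded up; \<open>3 * e \<le> ?w + 2\<close>
      keeps \<open>?w + e\<close> within the ceiling.\<close>
    define e where "e = (?w + 2) div 3"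
    have e: "?w \<le> 3 * e" "3 * e \<le> ?w + 2" "2 * e \<le> ?w" using w unfolding e_def by linarith+
    have "chromatic_number G \<le> ?w + e"
      unfolding chromatic_number_le_iff[OF G(1)] by (rule colorable_four_thirds[OF K w max e(1,3)])
    moreover have "int (?w + e) \<le> \<lceil>4 / 3 * real ?w\<rceil>"
      unfolding le_ceiling_iff using e(2) by simp
    ultimately show ?thesis by linarith
  qed
qed

section \<open>Extremal graphs\<close>

definition graph_of :: "'a set \<Rightarrow> ('a \<Rightarrow> 'a \<Rightarrow> bool) \<Rightarrow> 'a sgraph" where
  "graph_of V E = (V, {{u, v} | u v. u \<in> V \<and> v \<in> V \<and> u \<noteq> v \<and> E u v})"

lemma verts_graph_of [simp]: "verts (graph_of V E) = V"
  unfolding graph_of_def by simp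

lemma fin_sgraph_graph_of: "finite V \<Longrightarrow> fin_sgraph (graph_of V E)"
  unfolding graph_of_def fin_sgraph_def by auto

lemma adj_graph_of:
  assumes "\<And>u v. E u v \<Longrightarrow> E v u" "\<And>u. \<not> E u u"
  shows "adj (graph_of V E) u v \<longleftrightarrow> u \<in> V \<and> v \<in> V \<and> E u v"
proof
  show "u \<in> V \<and> v \<in> V \<and> E u v" if "adj (graph_of V E) u v"
    using that assms(1) unfolding graph_of_def adj_def by (auto simp: doubleton_eq_iff)
  assume uv: "u \<in> V \<and> v \<in> V \<and> E u v"
  then have "u \<noteq> v" using assms(2) by metis
  with uv show "adj (graph_of V E) u v" unfolding graph_of_def adj_def by auto
qed

text \<open>The 5-cycle is \<open>0, \<dots>, 4\<close>, the twin of \<open>i\<close> is \<open>5 + i\<close>, and \<open>10\<close> is joined to all twins.\<close>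

definition groetzsch_nbrs :: "nat \<Rightarrow> nat list" where
  "groetzsch_nbrs u = [[1, 4, 6, 9], [0, 2, 5, 7], [1, 3, 6, 8], [2, 4, 7, 9], [0, 3, 5, 8],
    [1, 4, 10], [0, 2, 10], [1, 3, 10], [2, 4, 10], [0, 3, 10], [5, 6, 7, 8, 9]] ! u"

definition groetzsch :: "nat sgraph" where
  "groetzsch = graph_of {..<11} (\<lambda>u v. u < 11 \<and> v \<in> set (groetzsch_nbrs u))"

lemma groetzsch_nbrs_sym:
  "\<forall>u\<in>set [0..<11]. \<forall>v\<in>set (groetzsch_nbrs u). v < 11 \<and> v \<noteq> u \<and> u \<in> set (groetzsch_nbrs v)"
  unfolding groetzsch_nbrs_def by code_simp

lemma groetzsch_triangle_free:
  "\<forall>u\<in>set [0..<11]. \<forall>v\<in>set (groetzsch_nbrs u). \<forall>x\<in>set (groetzsch_nbrs v). x \<notin> set (groetzsch_nbrs u)"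
  unfolding groetzsch_nbrs_def by code_simp

text \<open>Choosing the middle edge \<open>bc\<close> before the ends, and only among common
  non-neighbours of \<open>x\<close> and \<open>y\<close>, keeps the evaluation small.\<close>

lemma groetzsch_P2_P4_free:
  "\<forall>x\<in>set [0..<11]. \<forall>y\<in>set (groetzsch_nbrs x).
    let R = filter (\<lambda>v. v \<notin> set (groetzsch_nbrs x) \<and> v \<notin> set (groetzsch_nbrs y)) [0..<11] in
    \<forall>b\<in>set R. \<forall>c\<in>set R. c \<in> set (groetzsch_nbrs b) \<longrightarrow>
      (\<forall>a\<in>set R. a \<in> set (groetzsch_nbrs b) \<longrightarrow> a \<notin> set (groetzsch_nbrs c) \<longrightarrow>
        (\<forall>d\<in>set R. d \<in> set (groetzsch_nbrs c) \<longrightarrow> d \<in> set (groetzsch_nbrs b) \<or> d \<in> set (groetzsch_nbrs a)))"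
  unfolding groetzsch_nbrs_def by code_simp

lemma fin_sgraph_groetzsch: "fin_sgraph groetzsch"
  unfolding groetzsch_def by (simp add: fin_sgraph_graph_of)

lemma adj_groetzsch: "adj groetzsch u v \<longleftrightarrow> u < 11 \<and> v \<in> set (groetzsch_nbrs u)"
proof -
  have S: "v < 11 \<and> v \<noteq> u \<and> u \<in> set (groetzsch_nbrs v)" if "u < 11" "v \<in> set (groetzsch_nbrs u)" for u v
  proof -
    have "u \<in> set [0..<11]" using that(1) by (simp del: upt_Suc)
    then show ?thesis using groetzsch_nbrs_sym that(2) by blast
  qed
  have "adj groetzsch u v \<longleftrightarrow> u \<in> {..<11} \<and> v \<in> {..<11} \<and> u < 11 \<and> v \<in> set (groetzsch_nbrs u)"
    unfolding groetzsch_def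
  proof (rule adj_graph_of)
    show "v < 11 \<and> u \<in> set (groetzsch_nbrs v)" if "u < 11 \<and> v \<in> set (groetzsch_nbrs u)" for u v
      using S[of u v] that by simp
    show "\<not> (u < 11 \<and> u \<in> set (groetzsch_nbrs u))" for u using S[of u u] by auto
  qed
  then show ?thesis using S[of u v] by auto
qed

lemma adj_groetzsch_less: assumes "adj groetzsch u v" shows "u < 11 \<and> v < 11"
proof -
  interpret graph "verts groetzsch" "adj groetzsch" by (rule graph_adj[OF fin_sgraph_groetzsch])
  have "u \<in> verts groetzsch" "v \<in> verts groetzsch" using E_in_V assms sym[OF assms] by blast+
  then show ?thesis unfolding groetzsch_def by simp
qed

lemma no_triangle_groetzsch: "\<not> (adj groetzsch u v \<and> adj groetzsch v x \<and> adj groetzsch u x)"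
proof
  assume adj: "adj groetzsch u v \<and> adj groetzsch v x \<and> adj groetzsch u x"
  then have "u \<in> set [0..<11]" unfolding adj_groetzsch by (simp del: upt_Suc)
  then show False using groetzsch_triangle_free adj unfolding adj_groetzsch by blast
qed

lemma free_graph_groetzsch: "free_graph (verts groetzsch) (adj groetzsch)"
proof -
  interpret graph "verts groetzsch" "adj groetzsch" by (rule graph_adj[OF fin_sgraph_groetzsch])
  show ?thesis
  proof unfold_locales
    fix a b c d x y assume P4: "is_P4 a b c d" and xy: "adj groetzsch x y"
    show "adj groetzsch x a \<or> adj groetzsch x b \<or> adj groetzsch x c \<or> adj groetzsch x d \<or>
      adj groetzsch y a \<or> adj groetzsch y b \<or> adj groetzsch y c \<or> adj groetzsch y d"
    proof (rule ccontr)
      assume no: "\<not> ?thesis"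
      define R where "R = filter (\<lambda>v. v \<notin> set (groetzsch_nbrs x) \<and> v \<notin> set (groetzsch_nbrs y)) [0..<11]"
      have adj: "adj groetzsch b a" "adj groetzsch b c" "adj groetzsch c d"
        "\<not> adj groetzsch c a" "\<not> adj groetzsch b d" "\<not> adj groetzsch a d"
        using P4 sym unfolding is_P4_def by blast+
      have less: "x < 11" "y < 11" "a < 11" "b < 11" "c < 11" "d < 11"
        using adj_groetzsch_less adj xy by blast+
      have "a \<in> set R" "b \<in> set R" "c \<in> set R" "d \<in> set R"
        using no less unfolding R_def adj_groetzsch by (simp_all del: upt_Suc)
      moreover have "x \<in> set [0..<11]" "y \<in> set (groetzsch_nbrs x)"
        using xy less unfolding adj_groetzsch by (simp_all del: upt_Suc)
      ultimately show False
        using groetzsch_P2_P4_free[unfolded Let_def, folded R_def] adj less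
        unfolding adj_groetzsch R_def by blast
    qed
  qed (use no_triangle_groetzsch in blast)
qed

lemma clique_number_groetzsch: "clique_number groetzsch = 2"
proof -
  interpret graph "verts groetzsch" "adj groetzsch" by (rule graph_adj[OF fin_sgraph_groetzsch])
  have "adj groetzsch 0 1" unfolding adj_groetzsch groetzsch_nbrs_def by simp
  then have "is_clique {0, 1}" using sym unfolding is_clique_def by simp
  moreover have "{0, 1} \<subseteq> verts groetzsch" unfolding groetzsch_def by simp
  moreover have "card K \<le> 2" if K: "is_clique K" for K
  proof (rule ccontr)
    assume "\<not> ?thesis"
    then obtain T where T: "T \<subseteq> K" "card T = 3" using obtain_subset_with_card_n[of 3 K] by auto
    then obtain u v x where "T = {u, v, x}" "u \<noteq> v" "u \<noteq> x" "v \<noteq> x" unfolding card_3_iff by blast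
    then have "adj groetzsch u v" "adj groetzsch v x" "adj groetzsch u x"
      using is_cliqueD[OF K] T(1) by simp_all
    then show False using no_triangle_groetzsch by blast
  qed
  ultimately show ?thesis
    unfolding clique_number_eq[OF fin_sgraph_groetzsch] by (metis card_2_iff zero_neq_one)
qed

text \<open>Mycielski's argument: in a 3-colouring, giving each vertex of the 5-cycle that has the colour of
  vertex 10 the colour of its twin would leave a 2-colouring of the 5-cycle.\<close>

lemma groetzsch_not_3_colorable: "\<not> graph.colorable (adj groetzsch) (verts groetzsch) 3"
proof
  interpret graph "verts groetzsch" "adj groetzsch" by (rule graph_adj[OF fin_sgraph_groetzsch])
  assume "colorable (verts groetzsch) 3"
  then obtain c :: "nat \<Rightarrow> nat" where c: "\<forall>v\<in>verts groetzsch. c v < 3"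
    "\<forall>u\<in>verts groetzsch. \<forall>v\<in>verts groetzsch. adj groetzsch u v \<longrightarrow> c u \<noteq> c v"
    unfolding colorable_def by blast
  have less: "c v < 3" if "v < 11" for v using c(1) that unfolding groetzsch_def by simp
  have proper: "c u \<noteq> c v" if "adj groetzsch u v" for u v
    using c(2) that E_in_V[OF that] E_in_V[OF sym[OF that]] by blast
  define c' where "c' = (\<lambda>i. if c i = c 10 then c (5 + i) else c i)"
  have c': "c' i < 3" "c' i \<noteq> c 10" if "i < 5" for i
  proof -
    show "c' i < 3" using less that unfolding c'_def by simp
    have "10 \<in> set (groetzsch_nbrs (5 + i))"
      using that by (auto simp: groetzsch_nbrs_def less_Suc_eq eval_nat_numeral)
    then have "adj groetzsch (5 + i) 10" using that unfolding adj_groetzsch by simp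
    then show "c' i \<noteq> c 10" using proper unfolding c'_def by auto
  qed
  \<comment> \<open>Both colours cannot be replaced at once: adjacent \<open>i\<close> and
    \<open>j\<close> do not both have the colour of vertex 10.\<close>
  have nbr: "c' i \<noteq> c' j" if "adj groetzsch i j" "adj groetzsch i (5 + j)" "adj groetzsch (5 + i) j" for i j
    using proper[OF that(1)] proper[OF that(2)] proper[OF that(3)] unfolding c'_def by auto
  have cycle: "c' 0 \<noteq> c' 1" "c' 1 \<noteq> c' 2" "c' 2 \<noteq> c' 3" "c' 3 \<noteq> c' 4" "c' 4 \<noteq> c' 0"
    by (rule nbr; simp add: adj_groetzsch groetzsch_nbrs_def)+
  \<comment> \<open>With only two colours left, vertices at distance two on the cycle agree, so 0, 2
    and 4 share a colour although 4 and 0 are adjacent.\<close>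
  have "c' i = c' l" if "c' i \<noteq> c' j" "c' j \<noteq> c' l" "i < 5" "j < 5" "l < 5" for i j l
    using that c'[of i] c'[of j] c'[of l] less[of 10] by linarith
  from this[OF cycle(1,2)] this[OF cycle(3,4)] cycle(5) show False by simp
qed

lemma chromatic_number_groetzsch: "chromatic_number groetzsch = 4"
proof (rule antisym)
  show "chromatic_number groetzsch \<le> 4"
    using chromatic_number_bounds(1) fin_sgraph_groetzsch clique_number_groetzsch
      free_graph_adj[OF fin_sgraph_groetzsch] free_graph_groetzsch by blast
  show "4 \<le> chromatic_number groetzsch"
    using groetzsch_not_3_colorable chromatic_number_le_iff[OF fin_sgraph_groetzsch, of 3] by linarith
qed

text \<open>Vertex \<open>(s, i, j)\<close> is the vertex with index \<open>j\<close> in part \<open>i\<close> of the complete multipartite graph on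
  side \<open>s\<close>; it has one neighbour on the other side, with index \<open>i\<close> in part \<open>j\<close>.\<close>

fun linked :: "bool \<times> nat \<times> nat \<Rightarrow> bool \<times> nat \<times> nat \<Rightarrow> bool" where
  "linked (s, i, j) (s', i', j') \<longleftrightarrow> (if s = s' then i \<noteq> i' else i = j' \<and> j = i')"

text \<open>The triples are encoded by \<open>to_nat\<close> because the theorem asks for graphs on
  natural numbers.\<close>

definition tight :: "nat \<Rightarrow> nat sgraph" where
  "tight w = graph_of (to_nat ` ((UNIV :: bool set) \<times> {..<w} \<times> {..<w})) (\<lambda>u v. linked (from_nat u) (from_nat v))"

lemma linked_commute: "linked x y \<longleftrightarrow> linked y x"
  by (cases x; cases y) auto

lemma not_linked_self: "\<not> linked x x"
  by (cases x) auto

lemma fin_sgraph_tight: "fin_sgraph (tight w)"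
  unfolding tight_def by (intro fin_sgraph_graph_of) simp

lemma adj_tight: "adj (tight w) u v \<longleftrightarrow>
    u \<in> verts (tight w) \<and> v \<in> verts (tight w) \<and> linked (from_nat u) (from_nat v)"
  unfolding tight_def verts_graph_of by (rule adj_graph_of) (use linked_commute not_linked_self in blast)+

lemma adj_tight_to_nat: "adj (tight w) (to_nat (s, i, j)) (to_nat (s', i', j')) \<longleftrightarrow>
    i < w \<and> j < w \<and> i' < w \<and> j' < w \<and> linked (s, i, j) (s', i', j')"
  unfolding adj_tight by (auto simp: tight_def)

text \<open>Every \<open>P4\<close> uses both sides and meets two parts of one of them. A vertex
  that misses it must lie on the other side, in the single part met there; so \<open>x\<close> and
  \<open>y\<close> would share a part.\<close>

lemma linked_P2_P4_free:
  assumes "linked a b" "linked b c" "linked c d" "\<not> linked a c" "\<not> linked a d" "\<not> linked b d" "linked x y"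
    "\<not> linked x a" "\<not> linked x b" "\<not> linked x c" "\<not> linked x d"
    "\<not> linked y a" "\<not> linked y b" "\<not> linked y c" "\<not> linked y d"
  shows False
  using assms by (cases a; cases b; cases c; cases d; cases x; cases y) (auto split: if_splits)

text \<open>The edges between the sides form a matching, so every triangle stays on one side. All
  five vertices lie there, and \<open>v\<close> would share a part with both \<open>c\<close> and
  \<open>d\<close>.\<close>

lemma linked_HVN_free:
  assumes "linked a b" "linked a c" "linked a d" "linked b c" "linked b d" "linked c d"
    "linked v a" "linked v b" "\<not> linked v c" "\<not> linked v d"
  shows False
proof -
  obtain s i j where v: "v = (s, i, j)" by (cases v)
  have side: "fst x = fst y" if "linked x y" "linked x z" "linked y z" for x y z :: "bool \<times> nat \<times> nat"
    using that by (cases x; cases y; cases z) (auto split: if_splits)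
  have "fst a = fst b" "fst a = fst c" "fst a = fst d" "fst v = fst a"
    using side[of a b c] side[of a c b] side[of a d b] side[of v a b] assms linked_commute by metis+
  then show False using assms unfolding v by (cases a; cases b; cases c; cases d) auto
qed

lemma free_graph_tight: "free_graph (verts (tight w)) (adj (tight w))"
proof -
  interpret graph "verts (tight w)" "adj (tight w)" by (rule graph_adj[OF fin_sgraph_tight])
  show ?thesis
  proof unfold_locales
    fix a b c d x y assume "is_P4 a b c d" "adj (tight w) x y"
    then show "adj (tight w) x a \<or> adj (tight w) x b \<or> adj (tight w) x c \<or> adj (tight w) x d \<or>
      adj (tight w) y a \<or> adj (tight w) y b \<or> adj (tight w) y c \<or> adj (tight w) y d"
      using linked_P2_P4_free[of "from_nat a" "from_nat b" "from_nat c" "from_nat d" "from_nat x" "from_nat y"]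
      unfolding is_P4_def adj_tight by metis
  next
    fix a b c d v assume "adj (tight w) a b" "adj (tight w) a c" "adj (tight w) a d" "adj (tight w) b c"
      "adj (tight w) b d" "adj (tight w) c d" "adj (tight w) v a" "adj (tight w) v b"
    then show "adj (tight w) v c \<or> adj (tight w) v d"
      using linked_HVN_free[of "from_nat a" "from_nat b" "from_nat c" "from_nat d" "from_nat v"]
      unfolding adj_tight by metis
  qed
qed

lemma clique_number_tight:
  assumes w: "4 \<le> w" shows "clique_number (tight w) = w"
proof -
  interpret graph "verts (tight w)" "adj (tight w)" by (rule graph_adj[OF fin_sgraph_tight])
  have part: "fst (snd (from_nat u :: bool \<times> nat \<times> nat)) < w" if "u \<in> verts (tight w)" for u
    using that unfolding tight_def by auto
  let ?side = "\<lambda>u. fst (from_nat u :: bool \<times> nat \<times> nat)"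
  let ?part = "\<lambda>u. fst (snd (from_nat u :: bool \<times> nat \<times> nat))"
  have bound: "card K \<le> w" if K: "K \<subseteq> verts (tight w)" "is_clique K" for K
  proof -
    have L: "linked (from_nat u) (from_nat v)" if "u \<in> K" "v \<in> K" "u \<noteq> v" for u v
      using is_cliqueD[OF K(2) that] unfolding adj_tight by blast
    show ?thesis
    proof (cases "\<exists>u\<in>K. \<exists>v\<in>K. ?side u \<noteq> ?side v")
      case False
      have "?part u \<noteq> ?part v" if uv: "u \<in> K" "v \<in> K" "u \<noteq> v" for u v
      proof -
        obtain s i j where u: "from_nat u = (s :: bool, i :: nat, j :: nat)" by (metis prod_cases3)
        obtain s' i' j' where v: "from_nat v = (s' :: bool, i' :: nat, j' :: nat)" by (metis prod_cases3)
        have "s = s'" using False uv(1,2) u v by fastforce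
        then show ?thesis using L[OF uv] u v by simp
      qed
      then have "inj_on ?part K" unfolding inj_on_def by blast
      moreover have "?part ` K \<subseteq> {..<w}" using part K(1) by auto
      ultimately have "card K \<le> card {..<w}" using card_inj_on_le by blast
      then show ?thesis by simp
    next
      case True
      then obtain u v where uv: "u \<in> K" "v \<in> K" "?side u \<noteq> ?side v" by blast
      \<comment> \<open>A third vertex would form a triangle using both sides.\<close>
      have "K \<subseteq> {u, v}"
      proof
        fix x assume x: "x \<in> K"
        show "x \<in> {u, v}"
        proof (rule ccontr)
          assume "x \<notin> {u, v}"
          moreover have "u \<noteq> v" using uv by auto
          ultimately have xuv: "linked (from_nat x) (from_nat u)" "linked (from_nat x) (from_nat v)"
            "linked (from_nat u) (from_nat v)" using L x uv(1,2) by simp_all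
          obtain s i j where u: "from_nat u = (s :: bool, i :: nat, j :: nat)" by (metis prod_cases3)
          obtain s' i' j' where v: "from_nat v = (s' :: bool, i' :: nat, j' :: nat)" by (metis prod_cases3)
          obtain r k l where x': "from_nat x = (r :: bool, k :: nat, l :: nat)" by (metis prod_cases3)
          have "s \<noteq> s'" using uv(3) u v by simp
          then show False using xuv unfolding u v x' by (cases "r = s") (simp_all split: if_splits)
        qed
      qed
      then have "card K \<le> card {u, v}" by (intro card_mono) auto
      also have "\<dots> \<le> 2" by (simp add: card_insert_if)
      finally show ?thesis using w by simp
    qed
  qed
  let ?v = "\<lambda>i. to_nat (True, i :: nat, 0 :: nat)"
  have "is_clique (?v ` {..<w})"
    unfolding is_clique_def using w by (auto simp: adj_tight_to_nat)
  moreover have "?v ` {..<w} \<subseteq> verts (tight w)" unfolding tight_def using w by auto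
  moreover have "card (?v ` {..<w}) = w" by (subst card_image) (auto intro: inj_onI)
  ultimately show ?thesis unfolding clique_number_eq[OF fin_sgraph_tight] using bound by blast
qed

text \<open>A part that is not monochromatic has at least two colours, so at least \<open>2 * w - k\<close> parts of
  each side are monochromatic; monochromatic parts of different sides have different colours, since
  some edge joins them.\<close>

lemma tight_colors:
  assumes "graph.colorable (adj (tight w)) (verts (tight w)) k" and w: "0 < w"
  shows "4 * w \<le> 3 * k"
proof -
  interpret graph "verts (tight w)" "adj (tight w)" by (rule graph_adj[OF fin_sgraph_tight])
  obtain c where c: "\<And>v. v \<in> verts (tight w) \<Longrightarrow> c v < k"
    and proper: "\<And>u v. adj (tight w) u v \<Longrightarrow> c u \<noteq> c v"
    using assms(1) unfolding colorable_def adj_tight by blast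
  define C where "C = (\<lambda>s i. (\<lambda>j. c (to_nat (s :: bool, i :: nat, j :: nat))) ` {..<w})"
  define X where "X = (\<lambda>s. {i \<in> {..<w}. card (C s i) = 1})"
  have fin: "finite (C s i)" for s i unfolding C_def by simp
  have ne: "C s i \<noteq> {}" for s i unfolding C_def using w by auto
  have sub: "C s i \<subseteq> {..<k}" if "i < w" for s i
    unfolding C_def using c that by (auto simp: tight_def)
  have disj: "C s i \<inter> C s i' = {}" if "i < w" "i' < w" "i \<noteq> i'" for s i i'
    unfolding C_def using proper that by (fastforce simp: adj_tight_to_nat)
  have card_UN: "card (\<Union>i\<in>I. C s i) = (\<Sum>i\<in>I. card (C s i))" if "I \<subseteq> {..<w}" for I s
  proof (rule card_UN_disjoint)
    show "finite I" using that finite_subset by blast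
    show "\<forall>i\<in>I. \<forall>i'\<in>I. i \<noteq> i' \<longrightarrow> C s i \<inter> C s i' = {}" using disj that by blast
  qed (use fin in blast)
  have many: "2 * w \<le> k + card (X s)" for s
  proof -
    have "2 \<le> card (C s i) + (if i \<in> X s then 1 else 0)" if "i < w" for i
    proof -
      have "card (C s i) \<noteq> 0" using fin ne by (simp add: card_eq_0_iff)
      then show ?thesis using that unfolding X_def by auto
    qed
    then have "(\<Sum>i<w. 2) \<le> (\<Sum>i<w. card (C s i) + (if i \<in> X s then 1 else 0))"
      by (intro sum_mono) auto
    also have "\<dots> = (\<Sum>i<w. card (C s i)) + card (X s)"
      unfolding sum.distrib by (simp add: sum.If_cases X_def Int_def)
    also have "(\<Sum>i<w. card (C s i)) = card (\<Union>i<w. C s i)" using card_UN by simp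
    also have "\<dots> \<le> card {..<k}" using sub by (intro card_mono) auto
    finally show ?thesis by simp
  qed
  define D where "D = (\<lambda>s. \<Union>i\<in>X s. C s i)"
  have D: "card (D s) = card (X s)" "D s \<subseteq> {..<k}" for s
  proof -
    show "card (D s) = card (X s)" unfolding D_def by (subst card_UN) (auto simp: X_def)
    show "D s \<subseteq> {..<k}" unfolding D_def using sub by (auto simp: X_def)
  qed
  have "D True \<inter> D False = {}"
  proof (rule ccontr)
    assume "\<not> ?thesis"
    then obtain q i j where q: "q \<in> C True i" "q \<in> C False j" "i \<in> X True" "j \<in> X False"
      unfolding D_def by blast
    then have ij: "i < w" "j < w" "C True i = {q}" "C False j = {q}"
      unfolding X_def by (auto simp: card_1_singleton_iff)
    have "c (to_nat (True, i, j)) \<in> C True i" "c (to_nat (False, j, i)) \<in> C False j"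
      unfolding C_def using ij by auto
    then have "c (to_nat (True, i, j)) = c (to_nat (False, j, i))" using ij by simp
    moreover have "adj (tight w) (to_nat (True, i, j)) (to_nat (False, j, i))"
      unfolding adj_tight_to_nat using ij by simp
    ultimately show False using proper by blast
  qed
  then have "card (X True) + card (X False) = card (D True \<union> D False)"
    using D finite_subset by (metis card_Un_disjoint finite_lessThan)
  also have "\<dots> \<le> card {..<k}" using D(2) by (intro card_mono) auto
  \<comment> \<open>Adding both instances of \<open>many\<close> gives \<open>4 * w\<close> at most
    \<open>2 * k\<close> plus the number of all monochromatic parts, which is at most
    \<open>k\<close>.\<close>
  finally show ?thesis using many[of True] many[of False] by simp
qed

lemma chromatic_number_tight:
  assumes w: "4 \<le> w" shows "int (chromatic_number (tight w)) = \<lceil>4 / 3 * real w\<rceil>"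
proof (rule antisym)
  show "int (chromatic_number (tight w)) \<le> \<lceil>4 / 3 * real w\<rceil>"
    using chromatic_number_bounds(3)[OF fin_sgraph_tight, of w] clique_number_tight[OF w] w
      free_graph_adj[OF fin_sgraph_tight] free_graph_tight by simp
  have "4 * w \<le> 3 * chromatic_number (tight w)"
    by (rule tight_colors) (use w chromatic_number_le_iff[OF fin_sgraph_tight] in auto)
  then have "4 / 3 * real w \<le> real (chromatic_number (tight w))" by simp
  then show "\<lceil>4 / 3 * real w\<rceil> \<le> int (chromatic_number (tight w))" by (simp add: ceiling_le_iff)
qed

theorem theorem1p3:
  shows "(\<forall>G :: 'a sgraph. fin_sgraph G \<and> free_of P2_P4 G \<and> free_of HVN G \<longrightarrow>
            (clique_number G = 2 \<longrightarrow> chromatic_number G \<le> 4) \<and>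
            (clique_number G = 3 \<longrightarrow> chromatic_number G \<le> 10) \<and>
            (clique_number G \<ge> 4 \<longrightarrow>
               int (chromatic_number G) \<le> \<lceil>4 / 3 * real (clique_number G)\<rceil>)) \<and>
         (\<exists>G :: nat sgraph. fin_sgraph G \<and> free_of P2_P4 G \<and> free_of HVN G \<and>
            clique_number G = 2 \<and> chromatic_number G = 4) \<and>
         (\<forall>w :: nat. w \<ge> 4 \<longrightarrow>
            (\<exists>G :: nat sgraph. fin_sgraph G \<and> free_of P2_P4 G \<and> free_of HVN G \<and>
               clique_number G = w \<and> int (chromatic_number G) = \<lceil>4 / 3 * real w\<rceil>))"
proof (intro conjI allI impI)
  have "free_of P2_P4 groetzsch \<and> free_of HVN groetzsch"
    using free_graph_adj[OF fin_sgraph_groetzsch] free_graph_groetzsch by simp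
  then show "\<exists>G :: nat sgraph. fin_sgraph G \<and> free_of P2_P4 G \<and> free_of HVN G \<and>
      clique_number G = 2 \<and> chromatic_number G = 4"
    using fin_sgraph_groetzsch clique_number_groetzsch chromatic_number_groetzsch by blast
  fix w :: nat assume w: "4 \<le> w"
  have "free_of P2_P4 (tight w) \<and> free_of HVN (tight w)"
    using free_graph_adj[OF fin_sgraph_tight] free_graph_tight by simp
  then show "\<exists>G :: nat sgraph. fin_sgraph G \<and> free_of P2_P4 G \<and> free_of HVN G \<and>
      clique_number G = w \<and> int (chromatic_number G) = \<lceil>4 / 3 * real w\<rceil>"
    using fin_sgraph_tight clique_number_tight[OF w] chromatic_number_tight[OF w] by blast
qed (use chromatic_number_bounds in blast)+

end
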